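(* Consider the system $\dot x=f(x)$, $y=h(x)$ with $f:\mathbb{R}^n\to\mathbb{R}^n$, $h:\mathbb{R}^n\to\mathbb{R}^p$, and let $\mathcal{O}\subset\mathbb{R}^n$ be open. Assume that the system is backward complete within $\mathcal{O}+\delta_u$ for some $\delta_u>0$, and backward $\mathcal{O}$-distinguishable with corresponding constants $0<\delta_\Upsilon<\delta_d$, where $\delta_d\in(0,\delta_u)$. Let $\chi:\mathbb{R}^n\to\mathbb{R}$ satisfy $\chi(x)=1$ if $x\in\mathcal{O}+\delta_d$ and $\chi(x)=0$ if $x\notin\mathcal{O}+\delta_u$, and let $\breve X(x,t)$ denote the solution of $\dot x=\chi(x)f(x)$ with initial condition $x$ at $t=0$, with $\breve\sigma^-_{\mathbb{R}^n}(x)$ the left endpoint of its maximal interval of definition. Assume also the existence of an injective $C^1$ function $b:\mathbb{R}^p\to\mathbb{C}^p$, a continuous function $M:\mathcal{O}+\delta_\Upsilon\to\mathbb{R}^+$, and a negative real number $\ell$ such that, for each $x\in\mathcal{O}+\delta_\Upsilon$ and each $t\in(\breve\sigma^-_{\mathbb{R}^n}(x),0]$, $$\left|\exp(-\ell t)\,b(h(\breve X(x,t)))\right|+\left|\exp(-\ell t)\,\frac{\partial (b\circ h\circ\breve X)}{\partial x}(x,t)\right|\le M(x).$$ Then there exists a subset $S$ of $\mathbb{C}^{n+1}$ of zero Lebesgue measure such that the function $T:\mathrm{cl}(\mathcal{O})\to\mathbb{C}^{(n+1)\times p}$ defined by $$T(x)=\int_{-\infty}^0\exp(-As)\,B_{1}\,b(h(\breve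 X(x,s)))\,ds,\qquad B_{1}=(1,\ldots,1)^T\in\mathbb{R}^{n+1}$$ ($b$ being viewed as row-vector valued), is injective provided $A$ is a diagonal matrix whose $n+1$ complex eigenvalues $\lambda_i$ are such that $(\lambda_1,\ldots,\lambda_{n+1})$ is arbitrarily chosen in $\mathbb{C}^{n+1}\setminus S$ with each $\lambda_i$ having real part strictly smaller than $\ell$.
   Context: Standing assumptions: $f$ and $h$ are at least locally Lipschitz and $\chi$ is locally Lipschitz; moreover $f$, $h$ and $\chi$ are sufficiently smooth that $x\mapsto b(h(\breve X(x,t)))$ is continuously differentiable for each $t$. For $x\in\mathbb{R}^n$, $X(x,t)$ denotes the unique maximal solution of $\dot x=f(x)$ with initial condition $x$ at $t=0$. For an open set $U$ and $x\in U$, $(\sigma^-_{U}(x),\sigma^+_{U}(x))$ is the maximal interval (containing $0$) of definition of the solution $X(x,t)$ conditioned to take values in $U$. Backward completeness within an open set $U$: for each $x\in U$, $\sigma^-_{U}(x)>-\infty$ implies $\sigma^-_{U}(x)>\sigma^-_{\mathbb{R}^n}(x)$. Backward $\mathcal{O}$-distinguishability: there exist two strictly positive real numbers $\delta_\Upsilon<\delta_d$ such that, for each pair of distinct points $x_1,x_2$ in $\mathcal{O}+\delta_\Upsilon$, there exists a time $t\in(\max\{\sigma^-_{\mathcal{O}+\delta_d}(x_1),\sigma^-_{\mathcal{O}+\delta_d}(x_2)\},0]$ such that $h(X(x_1,t))\neq h(X(x_2,t))$. For a set $S$ and $\delta>0$, $S+\delta=\bigcup_{x\in S}\mathcal{B}_\delta(x)$,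 where $\mathcal{B}_\delta(x)$ is the open ball with center $x$ and radius $\delta$. $\mathrm{cl}$ denotes closure.
   Formalization: Added assumption: for x in O+δ_Υ, if the solution X̆(x,·) of ẋ=χ(x)f(x) escapes in finite backward time, then χ is bounded along it. Otherwise an unbounded χ can cause such an escape, and the integral over (−∞,0] defining T is undefined. *)

theory Defs
  imports "HOL-Analysis.Analysis"
begin

abbreviation locally_lipschitz :: "('a::metric_space \<Rightarrow> 'b::metric_space) \<Rightarrow> bool"
  where "locally_lipschitz f \<equiv> local_lipschitz (UNIV::real set) UNIV (\<lambda>_. f)"

definition enlarge :: "'a::metric_space set \<Rightarrow> real \<Rightarrow> 'a set"
  where "enlarge S \<delta> = (\<Union>x\<in>S. ball x \<delta>)"

definition C1_on :: "('a::real_normed_vector \<Rightarrow> 'b::real_normed_vector) \<Rightarrow> 'a set \<Rightarrow> bool"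
  where "C1_on g S \<longleftrightarrow>
    (\<exists>g' :: 'a \<Rightarrow> 'a \<Rightarrow>\<^sub>L 'b.
       (\<forall>x\<in>S. (g has_derivative blinfun_apply (g' x)) (at x)) \<and> continuous_on S g')"

definition solves_in ::
    "('a::real_normed_vector \<Rightarrow> 'a) \<Rightarrow> 'a set \<Rightarrow> 'a \<Rightarrow> real set \<Rightarrow> (real \<Rightarrow> 'a) \<Rightarrow> bool"
  where "solves_in f U x J u \<longleftrightarrow>
    open J \<and> is_interval J \<and> 0 \<in> J \<and> u 0 = x \<and>
    (\<forall>t\<in>J. u t \<in> U \<and> (u has_vector_derivative f (u t)) (at t))"

definition max_interval :: "('a::real_normed_vector \<Rightarrow> 'a) \<Rightarrow> 'a set \<Rightarrow> 'a \<Rightarrow> real set"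
  where "max_interval f U x = \<Union>{J. \<exists>u. solves_in f U x J u}"

text \<open>The left endpoint $\sigma^-_U(x)$ of the maximal interval; it may be $-\infty$.
  For \<^term>\<open>U = UNIV\<close> it is $\sigma^-_{\mathbb{R}^n}(x)$.\<close>

definition sigma_minus :: "('a::real_normed_vector \<Rightarrow> 'a) \<Rightarrow> 'a set \<Rightarrow> 'a \<Rightarrow> ereal"
  where "sigma_minus f U x = Inf (ereal ` max_interval f U x)"

text \<open>The value at time \<open>t\<close> of the maximal solution starting at \<open>x\<close>. It is meaningful
  only for \<^term>\<open>t \<in> max_interval f UNIV x\<close> and when solutions are unique,
  for instance when \<open>f\<close> is locally Lipschitz.\<close>

definition flow :: "('a::real_normed_vector \<Rightarrow> 'a) \<Rightarrow> 'a \<Rightarrow> real \<Rightarrow> 'a"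
  where "flow f x t = (THE v. \<exists>J u. solves_in f UNIV x J u \<and> t \<in> J \<and> u t = v)"

definition backward_complete_within :: "('a::real_normed_vector \<Rightarrow> 'a) \<Rightarrow> 'a set \<Rightarrow> bool"
  where "backward_complete_within f U \<longleftrightarrow>
    (\<forall>x\<in>U. sigma_minus f U x > -\<infinity> \<longrightarrow> sigma_minus f U x > sigma_minus f UNIV x)"

definition backward_distinguishable_with ::
    "('a::real_normed_vector \<Rightarrow> 'a) \<Rightarrow> ('a \<Rightarrow> 'b) \<Rightarrow> 'a set \<Rightarrow> real \<Rightarrow> real \<Rightarrow> bool"
  where "backward_distinguishable_with f h \<O> \<delta>\<^sub>\<Upsilon> \<delta>\<^sub>d \<longleftrightarrow>
    0 < \<delta>\<^sub>\<Upsilon> \<and> \<delta>\<^sub>\<Upsilon> < \<delta>\<^sub>d \<and>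
    (\<forall>x\<^sub>1\<in>enlarge \<O> \<delta>\<^sub>\<Upsilon>. \<forall>x\<^sub>2\<in>enlarge \<O> \<delta>\<^sub>\<Upsilon>. x\<^sub>1 \<noteq> x\<^sub>2 \<longrightarrow>
      (\<exists>t::real. max (sigma_minus f (enlarge \<O> \<delta>\<^sub>d) x\<^sub>1) (sigma_minus f (enlarge \<O> \<delta>\<^sub>d) x\<^sub>2) < ereal t
         \<and> t \<le> 0 \<and> h (flow f x\<^sub>1 t) \<noteq> h (flow f x\<^sub>2 t)))"

text \<open>Products and powers of type \<open>vec\<close> are componentwise, so the matrix exponential is
  written as a series of iterated matrix products.\<close>

definition matrix_exp :: "complex^'m^'m \<Rightarrow> complex^'m^'m"
  where "matrix_exp A = (\<Sum>k. (1 / fact k) *\<^sub>R (((**) A ^^ k) (mat 1)))"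

definition diag_matrix :: "complex^'m \<Rightarrow> complex^'m^'m"
  where "diag_matrix \<Lambda> = (\<chi> i j. if i = j then \<Lambda> $ i else 0)"

text \<open>The integrand $\exp(-As)\,B_1\,w(s)$, with \<open>B\<^sub>1\<close> the column of ones and \<open>w s\<close> read as
  a row vector.\<close>

definition T_integrand :: "complex^'m^'m \<Rightarrow> (real \<Rightarrow> complex^'p) \<Rightarrow> real \<Rightarrow> complex^'p^'m"
  where "T_integrand A w s =
    matrix_exp ((- s) *\<^sub>R A) ** (columnvector (vec 1) :: complex^1^'m) ** rowvector (w s)"

definition T_map :: "complex^'m^'m \<Rightarrow> ('a \<Rightarrow> real \<Rightarrow> complex^'p) \<Rightarrow> 'a \<Rightarrow> complex^'p^'m"
  where "T_map A w x = (LBINT s:{..0}. T_integrand A (w x) s)"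

text \<open>The cut-off function is written \<open>\<kappa>\<close>, since \<open>\<chi>\<close> is the binder for vectors.\<close>

abbreviation cut :: "('a \<Rightarrow> real) \<Rightarrow> ('a::real_normed_vector \<Rightarrow> 'a) \<Rightarrow> 'a \<Rightarrow> 'a"
  where "cut \<kappa> f \<equiv> (\<lambda>x. \<kappa> x *\<^sub>R f x)"

text \<open>For an unbounded cut-off \<open>\<kappa>\<close>, the system $\dot x = \kappa(x) f(x)$ can run through an infinite
  time span of $\dot x = f(x)$ in finite time, so that a solution escapes in finite backward time
  even if \<open>f\<close> is backward complete, and the integral defining $T$ is then meaningless. The
  following condition excludes just this. It holds trivially if \<open>\<kappa>\<close> is bounded, or if
  \<^prop>\<open>sigma_minus (cut \<kappa> f) UNIV x = -\<infinity>\<close>.\<close>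

definition no_cutoff_blowup :: "('a::real_normed_vector \<Rightarrow> 'a) \<Rightarrow> ('a \<Rightarrow> real) \<Rightarrow> 'a \<Rightarrow> bool"
  where "no_cutoff_blowup f \<kappa> x \<longleftrightarrow>
    (sigma_minus (cut \<kappa> f) UNIV x > -\<infinity> \<longrightarrow>
      bounded ((\<lambda>t. \<kappa> (flow (cut \<kappa> f) x t)) ` {t. sigma_minus (cut \<kappa> f) UNIV x < ereal t \<and> t \<le> 0}))"

end

theory Submission
  imports Defs "HOL-Complex_Analysis.Complex_Analysis"
begin

text \<open>Write \<open>w x s = b (h (X x s))\<close> for the flow \<open>X\<close> of the cut-off system. The \<open>(i, j)\<close> entry of
  \<open>T x\<close> is the Laplace transform of the \<open>j\<close>-th component of \<open>w x\<close> at \<open>\<Lambda> $ i\<close>, so \<open>T\<close> fails to be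
  injective only if the differences of the transforms for some \<open>x\<^sub>1 \<noteq> x\<^sub>2\<close> have all the \<open>\<Lambda> $ i\<close> as
  common zeros. These differences are holomorphic in the spectral variable, locally Lipschitz in
  \<open>(x\<^sub>1, x\<^sub>2)\<close>, and, by distinguishability and injectivity of the Laplace transform, not all
  identically zero. Hence their common zeros, as \<open>(x\<^sub>1, x\<^sub>2)\<close> varies, lie on countably many Lipschitz
  graphs over a space of real dimension \<open>2 n\<close>, and the bad \<open>\<Lambda>\<close> lie in countably many Lipschitz
  images of subsets of that space in a space of real dimension \<open>2 n + 2\<close>.\<close>

section \<open>Common zeros of holomorphic families\<close>

text \<open>The smoothness hypothesis and the bound by \<open>M\<close> enter through one
  consequence: a Lipschitz dependence on the point, locally uniform in the spectral variable. So
  \<open>holo_family\<close> asks for no derivative in the parameter, and zeros are followed by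
  estimates. The class is stable under differentiation in the spectral variable, which is what makes
  multiple zeros tractable. The order of the zero, the output component that is not identically zero
  and the local graph all range over countable sets, and each of the finitely many
  \<open>\<Lambda> $ i\<close> may use its own choice; this is why a countable union suffices. Pairs
  on the diagonal have to be removed, since there the differences vanish identically. A separate
  obstacle is that \<open>T\<close> needs the cut-off solution at all negative times. The cut-off
  \<open>\<kappa>\<close> is assumed neither bounded nor nonnegative and its support may be
  unbounded, so global existence has to be drawn from backward completeness of \<open>f\<close>, by
  a change of time.\<close>

definition holo_family ::
    "'a::metric_space set \<Rightarrow> complex set \<Rightarrow> ('a \<Rightarrow> complex \<Rightarrow> complex) \<Rightarrow> bool"
  where "holo_family Y \<Omega> F \<longleftrightarrow>
    (\<forall>x\<in>Y. F x holomorphic_on \<Omega>) \<and>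
    (\<forall>x0\<in>Y. \<forall>z0\<in>\<Omega>. \<exists>r>0. \<exists>L\<ge>0. cball z0 r \<subseteq> \<Omega> \<and>
      (\<forall>x\<in>Y \<inter> ball x0 r. \<forall>x'\<in>Y \<inter> ball x0 r. \<forall>z\<in>cball z0 r.
        norm (F x z - F x' z) \<le> L * dist x x'))"

lemma holo_familyE:
  assumes "holo_family Y \<Omega> F" "x0 \<in> Y" "z0 \<in> \<Omega>"
  obtains r L where "r > 0" "L \<ge> 0" "cball z0 r \<subseteq> \<Omega>"
    "\<And>x x' z. \<lbrakk>x \<in> Y; x' \<in> Y; dist x0 x < r; dist x0 x' < r; dist z0 z \<le> r\<rbrakk>
      \<Longrightarrow> norm (F x z - F x' z) \<le> L * dist x x'"
proof -
  obtain r L where "r > 0" "L \<ge> 0" "cball z0 r \<subseteq> \<Omega>"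
    "\<forall>x\<in>Y \<inter> ball x0 r. \<forall>x'\<in>Y \<inter> ball x0 r. \<forall>z\<in>cball z0 r.
        norm (F x z - F x' z) \<le> L * dist x x'"
    using assms unfolding holo_family_def by meson
  then show ?thesis by (intro that[of r L]) auto
qed

text \<open>Cauchy's estimate for \<open>F x - F x'\<close> on a circle of radius \<open>r/2\<close>
  about a point of the half-size disc turns the Lipschitz constant \<open>L\<close> into
  \<open>2 * L / r\<close>, at the price of halving the radius.\<close>

lemma holo_family_deriv:
  assumes "open \<Omega>" and F: "holo_family Y \<Omega> F"
  shows "holo_family Y \<Omega> (\<lambda>x. deriv (F x))"
  unfolding holo_family_def
proof (intro conjI ballI)
  have hol: "\<And>x. x \<in> Y \<Longrightarrow> F x holomorphic_on \<Omega>"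
    using F by (auto simp: holo_family_def)
  then show "deriv (F x) holomorphic_on \<Omega>" if "x \<in> Y" for x
    using \<open>open \<Omega>\<close> that by (simp add: holomorphic_deriv)
  fix x0 z0 assume "x0 \<in> Y" "z0 \<in> \<Omega>"
  then obtain r L where r: "r > 0" "L \<ge> 0" "cball z0 r \<subseteq> \<Omega>"
    and L: "\<And>x x' z. \<lbrakk>x \<in> Y; x' \<in> Y; dist x0 x < r; dist x0 x' < r; dist z0 z \<le> r\<rbrakk>
      \<Longrightarrow> norm (F x z - F x' z) \<le> L * dist x x'"
    using holo_familyE[OF F] by metis
  have "norm (deriv (F x) z - deriv (F x') z) \<le> (2 * L / r) * dist x x'"
    if "x \<in> Y" "x' \<in> Y" "dist x0 x < r/2" "dist x0 x' < r/2" "dist z0 z \<le> r/2" for x x' z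
  proof -
    have sub: "cball z (r/2) \<subseteq> cball z0 r"
    proof
      fix w assume "w \<in> cball z (r/2)"
      then show "w \<in> cball z0 r"
        using dist_triangle[of z0 w z] that by auto
    qed
    have sub\<Omega>: "cball z (r/2) \<subseteq> \<Omega>" using sub r by blast
    have zr: "z \<in> \<Omega>" using sub\<Omega> r by force
    let ?G = "\<lambda>w. F x w - F x' w"
    have holG: "?G holomorphic_on \<Omega>"
      using hol that by (intro holomorphic_intros) auto
    have "norm ((deriv ^^ 1) ?G z) \<le> fact 1 * (L * dist x x') / (r/2)^1"
    proof (rule Cauchy_inequality)
      show "?G holomorphic_on ball z (r/2)"
        using holG sub\<Omega> by (meson ball_subset_cball holomorphic_on_subset)
      show "continuous_on (cball z (r/2)) ?G"
        using holG sub\<Omega> by (meson holomorphic_on_imp_continuous_on holomorphic_on_subset)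
      show "norm (?G w) \<le> L * dist x x'" if "norm (z - w) = r/2" for w
      proof (rule L)
        have "w \<in> cball z (r/2)" using that by (simp add: dist_norm)
        then show "dist z0 w \<le> r" using sub by auto
      qed (use \<open>x \<in> Y\<close> \<open>x' \<in> Y\<close> \<open>dist x0 x < r/2\<close> \<open>dist x0 x' < r/2\<close> r in auto)
    qed (use r in auto)
    moreover have "deriv ?G z = deriv (F x) z - deriv (F x') z"
      using hol[OF \<open>x \<in> Y\<close>] hol[OF \<open>x' \<in> Y\<close>] zr \<open>open \<Omega>\<close>
      by (intro deriv_diff) (auto simp: holomorphic_on_imp_differentiable_at)
    ultimately show ?thesis by (simp add: field_simps)
  qed
  moreover have "cball z0 (r/2) \<subseteq> \<Omega>"
    using r subset_cball[of "r/2" r z0] by auto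
  ultimately show "\<exists>r>0. \<exists>L\<ge>0. cball z0 r \<subseteq> \<Omega> \<and>
      (\<forall>x\<in>Y \<inter> ball x0 r. \<forall>x'\<in>Y \<inter> ball x0 r. \<forall>z\<in>cball z0 r.
        norm (deriv (F x) z - deriv (F x') z) \<le> L * dist x x')"
    using r by (intro exI[of _ "r/2"] exI[of _ "2 * L / r"] conjI) auto
qed

lemma holo_family_higher_deriv:
  assumes "open \<Omega>" "holo_family Y \<Omega> F"
  shows "holo_family Y \<Omega> (\<lambda>x. (deriv ^^ k) (F x))"
  by (induction k) (simp_all add: assms holo_family_deriv)

text \<open>Two points over the same parameter must coincide, so such a set is the graph of a
  Lipschitz function on its projection. The relational form passes to subsets at once.\<close>

definition lipschitz_graph :: "('a::metric_space \<times> complex) set \<Rightarrow> bool"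
  where "lipschitz_graph P \<longleftrightarrow>
    (\<exists>C. \<forall>p\<in>P. \<forall>q\<in>P. dist (snd p) (snd q) \<le> C * dist (fst p) (fst q))"

text \<open>A quantitative substitute for the implicit function theorem.\<close>

lemma simple_zeros_lipschitz_graph:
  assumes "open \<Omega>" and F: "holo_family Y \<Omega> F" and "x0 \<in> Y" "z0 \<in> \<Omega>"
    and nz: "deriv (F x0) z0 \<noteq> 0"
  shows "\<exists>U. open U \<and> (x0, z0) \<in> U \<and> lipschitz_graph ({(x, z). x \<in> Y \<and> F x z = 0} \<inter> U)"
proof -
  have hol: "\<And>x. x \<in> Y \<Longrightarrow> F x holomorphic_on \<Omega>"
    using F by (auto simp: holo_family_def)
  define D where "D = deriv (F x0) z0"
  define c where "c = norm D"
  have c: "c > 0" using nz by (simp add: c_def D_def)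
  obtain r1 L1 where r1: "r1 > 0" "L1 \<ge> 0" "cball z0 r1 \<subseteq> \<Omega>"
    and L1: "\<And>x x' z. \<lbrakk>x \<in> Y; x' \<in> Y; dist x0 x < r1; dist x0 x' < r1; dist z0 z \<le> r1\<rbrakk>
      \<Longrightarrow> norm (F x z - F x' z) \<le> L1 * dist x x'"
    using holo_familyE[OF F \<open>x0 \<in> Y\<close> \<open>z0 \<in> \<Omega>\<close>] by metis
  obtain r2 L2 where r2: "r2 > 0" "L2 \<ge> 0" "cball z0 r2 \<subseteq> \<Omega>"
    and L2: "\<And>x x' z. \<lbrakk>x \<in> Y; x' \<in> Y; dist x0 x < r2; dist x0 x' < r2; dist z0 z \<le> r2\<rbrakk>
      \<Longrightarrow> norm (deriv (F x) z - deriv (F x') z) \<le> L2 * dist x x'"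
    using holo_familyE[OF holo_family_deriv[OF \<open>open \<Omega>\<close> F] \<open>x0 \<in> Y\<close> \<open>z0 \<in> \<Omega>\<close>] by metis
  have "isCont (deriv (F x0)) z0"
    using holomorphic_deriv[OF hol[OF \<open>x0 \<in> Y\<close>] \<open>open \<Omega>\<close>] \<open>open \<Omega>\<close> \<open>z0 \<in> \<Omega>\<close>
    by (meson continuous_on_eq_continuous_at holomorphic_on_imp_continuous_on)
  then obtain r3 where r3: "r3 > 0"
    and c3: "\<And>z. dist z0 z < r3 \<Longrightarrow> norm (deriv (F x0) z - D) < c/4"
    using c unfolding continuous_at_eps_delta D_def
    by (metis dist_commute dist_norm zero_less_divide_iff zero_less_numeral)
  \<comment> \<open>The derivative is to stay within \<open>c/2\<close> of \<open>D\<close>: one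
    \<open>c/4\<close> pays for moving the parameter, through \<open>L2 * r\<close>, the other for
    moving the point. The summand 1 covers \<open>L2 = 0\<close>.\<close>
  define r where "r = min (min r1 r2) (min r3 (c / (4 * (L2 + 1))))"
  have r: "r > 0" "r \<le> r1" "r \<le> r2" "r \<le> r3" "r \<le> c / (4 * (L2 + 1))"
    using r1 r2 r3 c by (auto simp: r_def)
  have L2r: "L2 * r \<le> c/4"
  proof -
    have "L2 * r \<le> (L2 + 1) * (c / (4 * (L2 + 1)))"
      using r r2 by (intro mult_mono) auto
    also have "\<dots> = c/4" using r2 by (simp add: field_simps)
    finally show ?thesis .
  qed
  \<comment> \<open>\<open>F x\<close> differs from the linear map \<open>D * z\<close>, which
    stretches by \<open>c\<close>, by a function with Lipschitz constant \<open>c/2\<close>.\<close>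
  have lower: "c/2 * dist z z' \<le> norm (F x z - F x z')"
    if x: "x \<in> Y" "dist x0 x < r" and z: "z \<in> ball z0 r" "z' \<in> ball z0 r" for x z z'
  proof -
    have sub: "ball z0 r \<subseteq> \<Omega>" using r1 r by force
    have "norm ((F x z - D * z) - (F x z' - D * z')) \<le> c/2 * norm (z - z')"
    proof (rule field_differentiable_bound[of "ball z0 r" _ "\<lambda>w. deriv (F x) w - D"])
      show "((\<lambda>w. F x w - D * w) has_field_derivative deriv (F x) w - D) (at w within ball z0 r)"
        if "w \<in> ball z0 r" for w
      proof -
        have "(F x has_field_derivative deriv (F x) w) (at w)"
          using hol[OF x(1)] \<open>open \<Omega>\<close> sub that holomorphic_derivI by blast
        then have "((\<lambda>w. F x w - D * w) has_field_derivative deriv (F x) w - D) (at w)"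
          by (auto intro!: derivative_eq_intros)
        then show ?thesis by (rule has_field_derivative_at_within)
      qed
      show "norm (deriv (F x) w - D) \<le> c/2" if w: "w \<in> ball z0 r" for w
      proof -
        have "norm (deriv (F x) w - deriv (F x0) w) \<le> L2 * dist x x0"
          using x w r \<open>x0 \<in> Y\<close> r2 by (intro L2) auto
        also have "\<dots> \<le> L2 * r" using x r2 by (intro mult_left_mono) (auto simp: dist_commute)
        finally have "norm (deriv (F x) w - deriv (F x0) w) \<le> c/4" using L2r by simp
        moreover have "norm (deriv (F x0) w - D) < c/4" using c3 w r by auto
        ultimately show ?thesis
          using norm_triangle_ineq[of "deriv (F x) w - deriv (F x0) w" "deriv (F x0) w - D"] by simp
      qed
    qed (use z in auto)
    moreover have "c * norm (z - z') = norm (D * (z - z'))"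
      by (simp add: c_def norm_mult)
    moreover have "norm (D * (z - z')) \<le> norm (F x z - F x z') + norm ((F x z - D * z) - (F x z' - D * z'))"
      using norm_triangle_ineq4[of "F x z - F x z'" "(F x z - D * z) - (F x z' - D * z')"]
      by (simp add: algebra_simps)
    ultimately show ?thesis by (simp add: dist_norm)
  qed
  have "dist z z' \<le> (2 * L1 / c) * dist x x'"
    if "x \<in> Y" "x' \<in> Y" "F x z = 0" "F x' z' = 0" "x \<in> ball x0 r" "x' \<in> ball x0 r"
      "z \<in> ball z0 r" "z' \<in> ball z0 r" for x x' z z'
  proof -
    have "c/2 * dist z z' \<le> norm (F x z - F x z')"
      using that by (intro lower) auto
    \<comment> \<open>Both \<open>F x z\<close> and \<open>F x' z'\<close> vanish, so moving the
      point at fixed parameter costs as much as moving the parameter at fixed point.\<close>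
    also have "\<dots> = norm (F x z' - F x' z')"
      using that by simp
    also have "\<dots> \<le> L1 * dist x x'"
      using that r by (intro L1) auto
    finally show ?thesis using c by (simp add: field_simps)
  qed
  then have "lipschitz_graph ({(x, z). x \<in> Y \<and> F x z = 0} \<inter> (ball x0 r \<times> ball z0 r))"
    unfolding lipschitz_graph_def by (intro exI[of _ "2 * L1 / c"]) auto
  then show ?thesis
    using r by (intro exI[of _ "ball x0 r \<times> ball z0 r"]) (auto intro: open_Times)
qed

lemma countable_lipschitz_graph_cover:
  fixes Z :: "('a::{metric_space, second_countable_topology} \<times> complex) set"
  assumes "\<And>p. p \<in> Z \<Longrightarrow> \<exists>U. open U \<and> p \<in> U \<and> lipschitz_graph (Z \<inter> U)"
  shows "\<exists>\<P>. countable \<P> \<and> Z \<subseteq> \<Union>\<P> \<and> (\<forall>P\<in>\<P>. lipschitz_graph P)"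
proof -
  define \<F> where "\<F> = {U. open U \<and> lipschitz_graph (Z \<inter> U)}"
  obtain \<F>' where F': "\<F>' \<subseteq> \<F>" "countable \<F>'" "\<Union>\<F>' = \<Union>\<F>"
    using Lindelof[of \<F>] by (auto simp: \<F>_def)
  have "Z \<subseteq> \<Union>\<F>'" using F' assms by (fastforce simp: \<F>_def)
  then show ?thesis
    using F' by (intro exI[of _ "(\<inter>) Z ` \<F>'"]) (auto simp: \<F>_def)
qed

text \<open>One parameter \<open>x\<close> determines every coordinate of \<open>\<Lambda>\<close>,
  so the set is a Lipschitz image of a set of parameters, and these have too small a dimension to
  fill the target.\<close>

lemma negligible_lipschitz_graph_fibres:
  fixes P :: "'m::finite \<Rightarrow> ('a::euclidean_space \<times> complex) set"
  assumes dim: "DIM('a) < 2 * CARD('m)" and P: "\<And>i. lipschitz_graph (P i)"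
  shows "negligible {\<Lambda> :: complex^'m. \<exists>x. \<forall>i. (x, \<Lambda> $ i) \<in> P i}"
proof -
  obtain C where C: "\<And>i p q. \<lbrakk>p \<in> P i; q \<in> P i\<rbrakk> \<Longrightarrow> dist (snd p) (snd q) \<le> C i * dist (fst p) (fst q)"
    using P unfolding lipschitz_graph_def by metis
  define \<phi> where "\<phi> i x = (SOME z. (x, z) \<in> P i)" for i x
  have \<phi>_eq: "\<phi> i x = z" if "(x, z) \<in> P i" for i x z
  proof -
    have "(x, \<phi> i x) \<in> P i" unfolding \<phi>_def using that by (rule someI)
    from C[OF this that] show ?thesis by simp
  qed
  define D where "D = {x. \<forall>i. \<exists>z. (x, z) \<in> P i}"
  define \<Phi> :: "'a \<times> real \<Rightarrow> complex^'m" where "\<Phi> p = (\<chi> i. \<phi> i (fst p))" for p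
  \<comment> \<open>\<open>D\<close> itself need not be null. An additional real coordinate fixed at
    0 makes it so, and the strict inequality in \<open>dim\<close> leaves room for this one
    dimension.\<close>
  have "D \<times> {0::real} \<subseteq> {p. (0, 1) \<bullet> p = 0}" by auto
  moreover have "negligible {p :: 'a \<times> real. (0, 1) \<bullet> p = 0}"
    by (rule negligible_hyperplane) (auto simp: zero_prod_def)
  ultimately have negD: "negligible (D \<times> {0::real})"
    using negligible_subset by blast
  have lip: "norm (\<Phi> q - \<Phi> p) \<le> (\<Sum>i\<in>UNIV. \<bar>C i\<bar>) * norm (q - p)"
    if pq: "p \<in> D \<times> {0}" "q \<in> D \<times> {0}" for p q
  proof -
    have "norm (\<Phi> q - \<Phi> p) \<le> (\<Sum>i\<in>UNIV. norm ((\<Phi> q - \<Phi> p) $ i))"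
      unfolding norm_vec_def by (rule L2_set_le_sum) simp
    also have "\<dots> \<le> (\<Sum>i\<in>UNIV. \<bar>C i\<bar> * norm (q - p))"
    proof (rule sum_mono)
      fix i
      obtain z w where zw: "(fst q, z) \<in> P i" "(fst p, w) \<in> P i"
        using pq unfolding D_def mem_Times_iff by blast
      have "norm ((\<Phi> q - \<Phi> p) $ i) = dist z w"
        using zw by (simp add: \<Phi>_def \<phi>_eq dist_norm)
      also have "\<dots> \<le> C i * dist (fst q) (fst p)"
        using C[OF zw] by simp
      also have "\<dots> \<le> \<bar>C i\<bar> * norm (q - p)"
        using dist_fst_le[of q p] by (intro mult_mono) (auto simp: dist_norm)
      finally show "norm ((\<Phi> q - \<Phi> p) $ i) \<le> \<bar>C i\<bar> * norm (q - p)" .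
    qed
    finally show ?thesis by (simp add: sum_distrib_right)
  qed
  have "negligible (\<Phi> ` (D \<times> {0}))"
  proof (rule negligible_locally_Lipschitz_image)
    show "DIM('a \<times> real) \<le> DIM(complex^'m)" using dim by simp
    show "\<exists>T B. open T \<and> p \<in> T \<and> (\<forall>q\<in>D \<times> {0} \<inter> T. norm (\<Phi> q - \<Phi> p) \<le> B * norm (q - p))"
      if "p \<in> D \<times> {0}" for p
      using lip[OF that] by (intro exI[of _ UNIV]) auto
  qed (rule negD)
  moreover have "{\<Lambda> :: complex^'m. \<exists>x. \<forall>i. (x, \<Lambda> $ i) \<in> P i} \<subseteq> \<Phi> ` (D \<times> {0})"
  proof clarify
    fix \<Lambda> :: "complex^'m" and x assume x: "\<forall>i. (x, \<Lambda> $ i) \<in> P i"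
    then have "\<Lambda> = \<Phi> (x, 0)" by (simp add: \<Phi>_def vec_eq_iff) (metis \<phi>_eq)
    moreover have "x \<in> D" using x by (auto simp: D_def)
    ultimately show "\<Lambda> \<in> \<Phi> ` (D \<times> {0})" by blast
  qed
  ultimately show ?thesis using negligible_subset by blast
qed

section \<open>The null set of common zeros\<close>

text \<open>A zero of order \<open>k\<close> of a holomorphic function is a simple zero of its derivative
  of order \<open>k - 1\<close>.\<close>

lemma finite_order_zero:
  assumes "f holomorphic_on \<Omega>" "open \<Omega>" "connected \<Omega>" "z \<in> \<Omega>" "f z = 0"
    and "w \<in> \<Omega>" "f w \<noteq> 0"
  shows "\<exists>k. (deriv ^^ k) f z = 0 \<and> deriv ((deriv ^^ k) f) z \<noteq> 0"
proof (rule ccontr)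
  assume *: "\<nexists>k. (deriv ^^ k) f z = 0 \<and> deriv ((deriv ^^ k) f) z \<noteq> 0"
  have "(deriv ^^ k) f z = 0" for k
    by (induction k) (use * assms in auto)
  then show False
    using holomorphic_fun_eq_0_on_connected[OF assms(1,2,3) _ assms(4,6)] assms(7) by simp
qed

text \<open>Each common zero of the family lies on one of countably many Lipschitz graphs over the
  parameter, whose dimension is smaller than that of \<open>\<complex>\<^sup>m\<close>.\<close>

proposition negligible_common_zeros:
  fixes g :: "'j::finite \<Rightarrow> 'a::euclidean_space \<Rightarrow> complex \<Rightarrow> complex"
  assumes dim: "DIM('a) < 2 * CARD('m::finite)"
    and \<Omega>: "open \<Omega>" "connected \<Omega>"
    and g: "\<And>j. holo_family Y \<Omega> (g j)"
    and nz: "\<And>x. x \<in> Y \<Longrightarrow> \<exists>j. \<exists>z\<in>\<Omega>. g j x z \<noteq> 0"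
  shows "negligible {\<Lambda> :: complex^'m. \<exists>x\<in>Y. \<forall>i. \<Lambda> $ i \<in> \<Omega> \<and> (\<forall>j. g j x (\<Lambda> $ i) = 0)}"
proof -
  define Z where "Z j k = {(x, z). x \<in> Y \<and> z \<in> \<Omega> \<and> (deriv ^^ k) (g j x) z = 0 \<and>
      deriv ((deriv ^^ k) (g j x)) z \<noteq> 0}" for j k
  have "\<exists>\<P>. countable \<P> \<and> Z j k \<subseteq> \<Union>\<P> \<and> (\<forall>P\<in>\<P>. lipschitz_graph P)" for j k
  proof (rule countable_lipschitz_graph_cover)
    fix p assume "p \<in> Z j k"
    then obtain x z where p: "p = (x, z)" "x \<in> Y" "z \<in> \<Omega>" "deriv ((deriv ^^ k) (g j x)) z \<noteq> 0"
      by (auto simp: Z_def)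
    obtain U where U: "open U" "p \<in> U"
      "lipschitz_graph ({(x, z). x \<in> Y \<and> (deriv ^^ k) (g j x) z = 0} \<inter> U)"
      using simple_zeros_lipschitz_graph[OF \<Omega>(1) holo_family_higher_deriv[OF \<Omega>(1) g] p(2,3,4)] p(1)
      by auto
    then have "lipschitz_graph (Z j k \<inter> U)"
      unfolding lipschitz_graph_def Z_def by (elim exE) (rule exI, blast)
    with U show "\<exists>U. open U \<and> p \<in> U \<and> lipschitz_graph (Z j k \<inter> U)" by blast
  qed
  then obtain \<P> where \<P>: "\<And>j k. countable (\<P> j k)" "\<And>j k. Z j k \<subseteq> \<Union>(\<P> j k)"
    "\<And>j k P. P \<in> \<P> j k \<Longrightarrow> lipschitz_graph P"
    by metis
  \<comment> \<open>The empty graph guarantees a nonempty family, so that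
    \<open>from_nat_into\<close> enumerates exactly \<open>\<Q>\<close>.\<close>
  define \<Q> where "\<Q> = insert {} (\<Union>j k. \<P> j k)"
  have \<Q>: "countable \<Q>" "\<Q> \<noteq> {}" "\<And>P. P \<in> \<Q> \<Longrightarrow> lipschitz_graph P"
    using \<P> by (auto simp: \<Q>_def countable_finite lipschitz_graph_def)
  define Q where "Q = from_nat_into \<Q>"
  have rangeQ: "range Q = \<Q>" using \<Q> by (simp add: Q_def)
  have cover: "\<exists>n. (x, z) \<in> Q n" if xz: "x \<in> Y" "z \<in> \<Omega>" "\<forall>j. g j x z = 0" for x z
  proof -
    \<comment> \<open>The component depends on \<open>x\<close>; the other components may vanish
      identically at this parameter.\<close>
    obtain j w where "w \<in> \<Omega>" "g j x w \<noteq> 0" using nz \<open>x \<in> Y\<close> by blast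
    moreover have "g j x holomorphic_on \<Omega>" using g \<open>x \<in> Y\<close> by (auto simp: holo_family_def)
    ultimately obtain k where "(x, z) \<in> Z j k"
      using finite_order_zero[of "g j x" \<Omega> z w] \<Omega> xz unfolding Z_def mem_Collect_eq case_prod_conv
      by blast
    then obtain P where "P \<in> \<P> j k" "(x, z) \<in> P" using \<P>(2)[of j k] by blast
    then have "P \<in> \<Q>" by (auto simp: \<Q>_def)
    with \<open>(x, z) \<in> P\<close> show ?thesis using rangeQ by (metis imageE)
  qed
  \<comment> \<open>The coordinates of \<open>\<Lambda>\<close> may lie on different graphs over the
    same \<open>x\<close>; \<open>\<sigma>\<close> records which. As \<open>'m\<close> is finite,
    there are countably many \<open>\<sigma>\<close>.\<close>
  have "negligible (\<Union>\<sigma>::'m \<Rightarrow> nat. {\<Lambda> :: complex^'m. \<exists>x. \<forall>i. (x, \<Lambda> $ i) \<in> Q (\<sigma> i)})"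
  proof (rule negligible_countable_Union)
    show "countable (range (\<lambda>\<sigma>::'m \<Rightarrow> nat. {\<Lambda> :: complex^'m. \<exists>x. \<forall>i. (x, \<Lambda> $ i) \<in> Q (\<sigma> i)}))"
      by simp
    show "negligible T" 
      if "T \<in> range (\<lambda>\<sigma>::'m \<Rightarrow> nat. {\<Lambda> :: complex^'m. \<exists>x. \<forall>i. (x, \<Lambda> $ i) \<in> Q (\<sigma> i)})" for T
      using that rangeQ \<Q>(3) by (auto intro!: negligible_lipschitz_graph_fibres[OF dim])
  qed
  moreover have "{\<Lambda> :: complex^'m. \<exists>x\<in>Y. \<forall>i. \<Lambda> $ i \<in> \<Omega> \<and> (\<forall>j. g j x (\<Lambda> $ i) = 0)}
    \<subseteq> (\<Union>\<sigma>::'m \<Rightarrow> nat. {\<Lambda> :: complex^'m. \<exists>x. \<forall>i. (x, \<Lambda> $ i) \<in> Q (\<sigma> i)})"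
  proof clarify
    fix \<Lambda> :: "complex^'m" and x
    assume "x \<in> Y" "\<forall>i. \<Lambda> $ i \<in> \<Omega> \<and> (\<forall>j. g j x (\<Lambda> $ i) = 0)"
    then have "\<forall>i. \<exists>n. (x, \<Lambda> $ i) \<in> Q n" using cover by blast
    then obtain \<sigma> where "\<forall>i. (x, \<Lambda> $ i) \<in> Q (\<sigma> i)" by metis
    then show "\<Lambda> \<in> (\<Union>\<sigma>::'m \<Rightarrow> nat. {\<Lambda> :: complex^'m. \<exists>x. \<forall>i. (x, \<Lambda> $ i) \<in> Q (\<sigma> i)})" by blast
  qed
  ultimately show ?thesis using negligible_subset by blast
qed

section \<open>The Laplace transform on the negative half-line\<close>

lemma set_integrable_exp_atMost_0:
  fixes a :: real
  assumes "a > 0"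
  shows "set_integrable lborel {..0} (\<lambda>s. exp (a * s))"
proof -
  \<comment> \<open>The open interval ends at 1 so that it contains the closed half-line.\<close>
  have "set_integrable lborel (einterval (-\<infinity>) 1) (\<lambda>s. exp (a * s))"
  proof (rule interval_integral_FTC_nonneg(1))
    show "DERIV (\<lambda>s. exp (a * s) / a) s :> exp (a * s)" for s
      using assms by (auto intro!: derivative_eq_intros)
    show "(((\<lambda>s. exp (a * s) / a) \<circ> real_of_ereal) \<longlongrightarrow> 0) (at_right (-\<infinity>))"
    proof -
      have "filterlim (\<lambda>s. a * s) at_bot at_bot"
        by (rule filterlim_tendsto_pos_mult_at_bot[OF tendsto_const assms filterlim_ident])
      then have "((\<lambda>s. exp (a * s) / a) \<longlongrightarrow> 0 / a) at_bot"
        by (intro tendsto_divide filterlim_compose[OF exp_at_bot]) (use assms in auto)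
      then show ?thesis by (simp add: ereal_tendsto_simps)
    qed
    show "(((\<lambda>s. exp (a * s) / a) \<circ> real_of_ereal) \<longlongrightarrow> exp (a * 1) / a) (at_left 1)"
    proof -
      have "((\<lambda>s. exp (a * s) / a) \<longlongrightarrow> exp (a * 1) / a) (at_left 1)"
        using assms by (intro tendsto_intros) auto
      then show ?thesis unfolding one_ereal_def by (simp only: ereal_tendsto_simps)
    qed
  qed auto
  then show ?thesis by (rule set_integrable_subset) (auto simp: einterval_def)
qed

text \<open>On the negative half-line a signal of size \<open>exp (l * s)\<close> gives an integrand
  of size \<open>exp ((l - Re z) * s)\<close>; hence convergence in the left half-plane
  \<open>Re z < l\<close>.\<close>

definition laplace :: "(real \<Rightarrow> complex) \<Rightarrow> complex \<Rightarrow> complex"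
  where "laplace \<phi> z = (LBINT s:{..0}. exp (- (z * of_real s)) * \<phi> s)"

text \<open>Measurability instead of continuity admits truncated signals, which may jump.\<close>

definition exp_bounded :: "real \<Rightarrow> real \<Rightarrow> (real \<Rightarrow> complex) \<Rightarrow> bool"
  where "exp_bounded l C \<phi> \<longleftrightarrow>
    set_borel_measurable borel {..0} \<phi> \<and> (\<forall>s\<le>0. norm (\<phi> s) \<le> C * exp (l * s))"

lemma exp_bounded_diff:
  assumes "exp_bounded l C \<phi>" "exp_bounded l D \<psi>"
  shows "exp_bounded l (C + D) (\<lambda>s. \<phi> s - \<psi> s)"
proof -
  have "norm (\<phi> s - \<psi> s) \<le> (C + D) * exp (l * s)" if "s \<le> 0" for s
    using assms that unfolding exp_bounded_def distrib_right
    by (intro order_trans[OF norm_triangle_ineq4] add_mono) auto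
  moreover have "(\<lambda>s. indicator {..0} s *\<^sub>R (\<phi> s - \<psi> s)) \<in> borel_measurable borel"
    using assms by (auto simp: exp_bounded_def set_borel_measurable_def scaleR_diff_right)
  ultimately show ?thesis by (simp add: exp_bounded_def set_borel_measurable_def)
qed

lemma laplace_integrand_bound:
  assumes "exp_bounded l C \<phi>" "d \<le> l - Re z" "s \<le> 0" "0 \<le> C"
  shows "norm (exp (- (z * of_real s)) * \<phi> s) \<le> C * exp (d * s)"
proof -
  have "norm (exp (- (z * of_real s)) * \<phi> s) \<le> exp (- (Re z * s)) * (C * exp (l * s))"
    using assms by (simp add: norm_mult exp_bounded_def mult_left_mono)
  also have "\<dots> = C * exp ((l - Re z) * s)"
    by (simp add: algebra_simps flip: exp_add)
  also have "\<dots> \<le> C * exp (d * s)"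
    using assms by (intro mult_left_mono) (auto intro: mult_right_mono_neg)
  finally show ?thesis .
qed

lemma exp_bounded_nonneg:
  assumes "exp_bounded l C \<phi>"
  shows "0 \<le> C"
proof -
  have "norm (\<phi> 0) \<le> C * exp (l * 0)" using assms unfolding exp_bounded_def by blast
  then show ?thesis by (metis exp_zero mult.right_neutral mult_zero_right norm_ge_zero order_trans)
qed

lemma laplace_integrable:
  assumes \<phi>: "exp_bounded l C \<phi>" and "Re z < l"
  shows "set_integrable lborel {..0} (\<lambda>s. exp (- (z * of_real s)) * \<phi> s)"
proof (rule set_integrable_bound)
  show "set_integrable lborel {..0} (\<lambda>s. C * exp ((l - Re z) * s))"
    using assms by (intro set_integrable_mult_right set_integrable_exp_atMost_0) auto
  have "(\<lambda>s. exp (- (z * of_real s)) * (indicator {..0} s *\<^sub>R \<phi> s)) \<in> borel_measurable borel"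
    using \<phi> unfolding exp_bounded_def set_borel_measurable_def
    by (intro borel_measurable_times) (auto intro!: borel_measurable_continuous_onI continuous_intros)
  then show "set_borel_measurable lborel {..0} (\<lambda>s. exp (- (z * of_real s)) * \<phi> s)"
    by (simp add: set_borel_measurable_def)
  show "AE s in lborel. s \<in> {..0} \<longrightarrow> norm (exp (- (z * of_real s)) * \<phi> s)
      \<le> norm (C * exp ((l - Re z) * s))"
    using laplace_integrand_bound[OF \<phi>] exp_bounded_nonneg[OF \<phi>] by auto
qed

text \<open>The estimate is uniform over \<open>Re z \<le> l - d\<close> and linear in
  \<open>C\<close>. The first makes truncation errors small locally uniformly, the second carries
  Lipschitz dependence from signals to transforms.\<close>

lemma norm_laplace_le:
  assumes \<phi>: "exp_bounded l C \<phi>" and d: "0 < d" "d \<le> l - Re z"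
  shows "norm (laplace \<phi> z) \<le> C * (LBINT s:{..0}. exp (d * s))"
proof -
  have int: "set_integrable lborel {..0} (\<lambda>s. exp (- (z * of_real s)) * \<phi> s)"
    using laplace_integrable[OF \<phi>] d by simp
  have "norm (laplace \<phi> z) \<le> (LBINT s:{..0}. norm (exp (- (z * of_real s)) * \<phi> s))"
    unfolding laplace_def by (rule set_integral_norm_bound[OF int])
  also have "\<dots> \<le> (LBINT s:{..0}. C * exp (d * s))"
    using laplace_integrand_bound[OF \<phi> d(2)] exp_bounded_nonneg[OF \<phi>]
    by (intro set_integral_mono set_integrable_norm int set_integrable_mult_right
        set_integrable_exp_atMost_0 d) auto
  finally show ?thesis by simp
qed

lemma set_integral_sum:
  fixes f :: "'i \<Rightarrow> 'a \<Rightarrow> 'b::{banach, second_countable_topology}"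
  assumes "\<And>i. i \<in> I \<Longrightarrow> set_integrable M A (f i)"
  shows "(LINT x:A|M. (\<Sum>i\<in>I. f i x)) = (\<Sum>i\<in>I. LINT x:A|M. f i x)"
  using assms unfolding set_lebesgue_integral_def set_integrable_def scaleR_sum_right
  by (rule Bochner_Integration.integral_sum)

lemma laplace_diff:
  assumes "exp_bounded l C \<phi>" "exp_bounded l D \<psi>" "Re z < l"
  shows "laplace (\<lambda>s. \<phi> s - \<psi> s) z = laplace \<phi> z - laplace \<psi> z"
  unfolding laplace_def right_diff_distrib
  by (rule set_integral_diff(2)[OF laplace_integrable[OF assms(1,3)] laplace_integrable[OF assms(2,3)]])

text \<open>The truncated transform is an integral over a compact interval and can be differentiated
  under the integral sign at every \<open>z\<close>.\<close>

lemma laplace_compact_holomorphic: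
  assumes cont: "continuous_on {..0} \<phi>" and "a \<le> 0"
  shows "laplace (\<lambda>s. indicator {a..0} s *\<^sub>R \<phi> s) holomorphic_on U"
proof -
  have cont': "continuous_on {a..0} \<phi>" using cont by (rule continuous_on_subset) auto
  have "(\<lambda>z. integral (cbox a 0) (\<lambda>s. exp (- (z * of_real s)) * \<phi> s)) holomorphic_on UNIV"
  proof (rule leibniz_rule_holomorphic)
    show "((\<lambda>z. exp (- (z * of_real s)) * \<phi> s) has_field_derivative
        - of_real s * exp (- (z * of_real s)) * \<phi> s) (at z within UNIV)" for z s
      by (auto intro!: derivative_eq_intros)
    show "(\<lambda>s. exp (- (z * of_real s)) * \<phi> s) integrable_on cbox a 0" for z
      using cont' by (intro integrable_continuous) (auto intro!: continuous_intros)
    have "continuous_on (UNIV \<times> cbox a 0) (\<lambda>p. \<phi> (snd p))"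
      by (rule continuous_on_compose2[OF cont']) (auto intro!: continuous_intros)
    then show "continuous_on (UNIV \<times> cbox a 0)
        (\<lambda>(z, s). - of_real s * exp (- (z * of_real s)) * \<phi> s)"
      unfolding case_prod_unfold by (intro continuous_intros) auto
  qed auto
  moreover have "laplace (\<lambda>s. indicator {a..0} s *\<^sub>R \<phi> s) z =
      integral (cbox a 0) (\<lambda>s. exp (- (z * of_real s)) * \<phi> s)" for z
  proof -
    have "set_integrable lborel {a..0} (\<lambda>s. exp (- (z * of_real s)) * \<phi> s)"
      using cont' by (intro borel_integrable_atLeastAtMost') (auto intro!: continuous_intros)
    then have "(LBINT s:{a..0}. exp (- (z * of_real s)) * \<phi> s) =
        integral {a..0} (\<lambda>s. exp (- (z * of_real s)) * \<phi> s)"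
      by (rule set_borel_integral_eq_integral)
    moreover have "laplace (\<lambda>s. indicator {a..0} s *\<^sub>R \<phi> s) z =
        (LBINT s:{a..0}. exp (- (z * of_real s)) * \<phi> s)"
      unfolding laplace_def set_lebesgue_integral_def
      by (intro Bochner_Integration.integral_cong) (auto simp: indicator_def)
    ultimately show ?thesis by simp
  qed
  then have "laplace (\<lambda>s. indicator {a..0} s *\<^sub>R \<phi> s) =
      (\<lambda>z. integral (cbox a 0) (\<lambda>s. exp (- (z * of_real s)) * \<phi> s))" ..
  ultimately show ?thesis using holomorphic_on_subset by (metis subset_UNIV)
qed

lemma exp_bounded_continuous:
  assumes "continuous_on {..0} \<phi>" "\<And>s. s \<le> 0 \<Longrightarrow> norm (\<phi> s) \<le> C * exp (l * s)"
  shows "exp_bounded l C \<phi>"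
  unfolding exp_bounded_def set_borel_measurable_def
  using borel_measurable_continuous_on_indicator[OF _ assms(1)] assms(2) by simp

text \<open>Truncation at \<open>- n\<close> gives entire functions; they converge uniformly on
  discs inside the half-plane.\<close>

lemma laplace_holomorphic:
  assumes cont: "continuous_on {..0} \<phi>" and bd: "\<And>s. s \<le> 0 \<Longrightarrow> norm (\<phi> s) \<le> C * exp (l * s)"
  shows "laplace \<phi> holomorphic_on {z. Re z < l}"
proof (rule holomorphic_uniform_sequence)
  have \<phi>: "exp_bounded l C \<phi>" using assms by (rule exp_bounded_continuous)
  define \<phi>' where "\<phi>' n s = indicator {- real n..0} s *\<^sub>R \<phi> s" for n s
  show "laplace (\<phi>' n) holomorphic_on {z. Re z < l}" for n
    unfolding \<phi>'_def using laplace_compact_holomorphic[OF cont] by simp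
  show "open {z. Re z < l}" by (rule open_halfspace_Re_lt)
  have \<phi>': "exp_bounded l C (\<phi>' n)" for n
  proof -
    have "(\<lambda>s. indicator {- real n..} s *\<^sub>R (indicator {..0} s *\<^sub>R \<phi> s)) \<in> borel_measurable borel"
      by (rule borel_measurable_scaleR[OF borel_measurable_indicator])
        (use \<phi> in \<open>simp_all add: exp_bounded_def set_borel_measurable_def\<close>)
    moreover have "(\<lambda>s. indicator {- real n..} s *\<^sub>R (indicator {..0} s *\<^sub>R \<phi> s)) =
        (\<lambda>s. indicator {..0} s *\<^sub>R \<phi>' n s)"
      by (auto simp: \<phi>'_def indicator_def)
    moreover have "norm (\<phi>' n s) \<le> norm (\<phi> s)" for s
      by (auto simp: \<phi>'_def indicator_def)
    ultimately show ?thesis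
      using bd unfolding exp_bounded_def set_borel_measurable_def by (metis order_trans)
  qed
  fix w assume w: "w \<in> {z. Re z < l}"
  define d where "d = (l - Re w) / 2"
  have d: "d > 0" using w by (simp add: d_def)
  define E where "E = (LBINT s:{..0}. exp (d/2 * s))"
  have Re_d: "d \<le> l - Re z" if "z \<in> cball w d" for z
  proof -
    have "\<bar>Re (w - z)\<bar> \<le> d" using that abs_Re_le_cmod[of "w - z"] by (simp add: dist_norm)
    then show ?thesis by (simp add: d_def field_simps abs_if split: if_splits)
  qed
  have "norm (laplace \<phi> z - laplace (\<phi>' n) z) \<le> C * exp (- (d/2 * n)) * E" if "z \<in> cball w d" for z n
  proof -
    \<comment> \<open>The decay margin \<open>d\<close> is split: for \<open>s < - n\<close> the
      factor \<open>exp (d/2 * s)\<close> is below \<open>exp (- (d/2 * n))\<close>, and the other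
      half keeps the integral finite.\<close>
    have "norm (\<phi> s - \<phi>' n s) \<le> C * exp (- (d/2 * n)) * exp ((l - d/2) * s)" if "s \<le> 0" for s
    proof (cases "s < - real n")
      case True
      have "norm (\<phi> s - \<phi>' n s) \<le> C * exp (l * s)"
        using True bd[OF \<open>s \<le> 0\<close>] by (simp add: \<phi>'_def)
      also have "l * s \<le> - (d/2 * n) + (l - d/2) * s"
        using mult_left_mono[of s "- real n" "d/2"] True d by (simp add: algebra_simps)
      then have "C * exp (l * s) \<le> C * exp (- (d/2 * n) + (l - d/2) * s)"
        using exp_bounded_nonneg[OF \<phi>] by (intro mult_left_mono) auto
      finally show ?thesis unfolding exp_add mult.assoc .
    qed (use that exp_bounded_nonneg[OF \<phi>] in \<open>auto simp: \<phi>'_def\<close>)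
    then have "exp_bounded (l - d/2) (C * exp (- (d/2 * n))) (\<lambda>s. \<phi> s - \<phi>' n s)"
      using exp_bounded_diff[OF \<phi> \<phi>'] by (simp add: exp_bounded_def)
    from norm_laplace_le[OF this, of "d/2" z]
    have "norm (laplace (\<lambda>s. \<phi> s - \<phi>' n s) z) \<le> C * exp (- (d/2 * n)) * E"
      using d Re_d[OF that] unfolding E_def by simp
    then show ?thesis
      using laplace_diff[OF \<phi> \<phi>'] d Re_d[OF that] by simp
  qed
  moreover have "(\<lambda>n. C * exp (- (d/2 * real n)) * E) \<longlonglongrightarrow> C * 0 * E"
  proof (intro tendsto_intros filterlim_compose[OF exp_at_bot])
    show "filterlim (\<lambda>n. - (d/2 * real n)) at_bot sequentially"
      unfolding filterlim_uminus_at_top[symmetric]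
      by (rule filterlim_tendsto_pos_mult_at_top[OF tendsto_const _ filterlim_real_sequentially])
        (use d in simp)
  qed
  ultimately have bound: "\<And>z n. z \<in> cball w d \<Longrightarrow> dist (laplace (\<phi>' n) z) (laplace \<phi> z) \<le> C * exp (- (d/2 * real n)) * E"
    and lim: "(\<lambda>n. C * exp (- (d/2 * real n)) * E) \<longlonglongrightarrow> 0"
    by (simp_all add: dist_norm norm_minus_commute)
  have "uniform_limit (cball w d) (\<lambda>n. laplace (\<phi>' n)) (laplace \<phi>) sequentially"
  proof (rule uniform_limitI)
    fix e :: real assume "e > 0"
    show "\<forall>\<^sub>F n in sequentially. \<forall>z\<in>cball w d. dist (laplace (\<phi>' n) z) (laplace \<phi> z) < e"
      using order_tendstoD(2)[OF lim \<open>e > 0\<close>]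
      by eventually_elim (use bound in \<open>blast intro: order.strict_trans1\<close>)
  qed
  moreover have "cball w d \<subseteq> {z. Re z < l}"
    using Re_d d by fastforce
  ultimately show "\<exists>d>0. cball w d \<subseteq> {z. Re z < l} \<and>
      uniform_limit (cball w d) (\<lambda>n. laplace (\<phi>' n)) (laplace \<phi>) sequentially"
    using d by blast
qed

section \<open>Injectivity of the Laplace transform\<close>

text \<open>By the substitution \<open>u = exp s\<close> the hypothesis becomes the vanishing of all moments on \<open>[0, 1]\<close>
  of a continuous function, to which the Weierstrass theorem applies.\<close>

lemma exponential_moments_eq_0:
  fixes \<Psi> :: "real \<Rightarrow> real"
  assumes cont: "continuous_on {..0} \<Psi>" and bd: "\<And>s. s \<le> 0 \<Longrightarrow> \<bar>\<Psi> s\<bar> \<le> C * exp s"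
    and zero: "\<And>k::nat. (LBINT s:{..0}. exp s ^ k * \<Psi> s) = 0"
    and "s0 \<le> 0"
  shows "\<Psi> s0 = 0"
proof -
  \<comment> \<open>The bound \<open>C * exp s\<close> becomes \<open>C * u\<close>, which forces
    the value 0 at \<open>u = 0\<close>. The \<open>min\<close> extends \<open>q\<close> constantly
    beyond 1 and keeps it continuous there.\<close>
  define q where "q u = (if u \<le> 0 then 0 else \<Psi> (min 0 (ln u)))" for u
  have C: "0 \<le> C" using bd[of 0] by simp
  have q_exp: "q (exp s) = \<Psi> s" if "s \<le> 0" for s
    using that by (simp add: q_def)
  have "continuous_on {0..1} q"
    unfolding continuous_on_eq_continuous_within
  proof
    fix u :: real assume u: "u \<in> {0..1}"
    show "continuous (at u within {0..1}) q"
    proof (cases "u = 0")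
      case True
      have "((\<lambda>u. C * u) \<longlongrightarrow> C * 0) (at 0 within {0..1})"
        by (intro tendsto_intros)
      moreover have "norm (q u) \<le> C * u" if "u \<in> {0..1}" for u
        using bd[of "ln u"] that by (auto simp: q_def min_def)
      ultimately have "(q \<longlongrightarrow> 0) (at 0 within {0..1})"
        by (intro Lim_null_comparison[of q "\<lambda>u. C * u"]) (simp_all add: eventually_at_filter)
      then show ?thesis using True by (simp add: continuous_within q_def)
    next
      case False
      then have "u > 0" using u by simp
      have "isCont (\<lambda>u. \<Psi> (min 0 (ln u))) u"
      proof -
        have "continuous_on {0<..} (\<lambda>u. \<Psi> (min 0 (ln u)))"
          by (rule continuous_on_compose2[OF cont]) (auto intro!: continuous_intros)
        then show ?thesis using \<open>u > 0\<close> by (simp add: continuous_on_eq_continuous_at)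
      qed
      moreover have "\<forall>\<^sub>F v in nhds u. q v = \<Psi> (min 0 (ln v))"
        using eventually_nhds_in_open[of "{0<..}" u] \<open>u > 0\<close>
        by (auto elim!: eventually_mono simp: q_def)
      ultimately have "isCont q u" using isCont_cong[of q "\<lambda>v. \<Psi> (min 0 (ln v))" u] by simp
      then show ?thesis by (rule continuous_at_imp_continuous_within)
    qed
  qed
  then have approx: "\<exists>n a. \<forall>u\<in>{0..1}. \<bar>q u - (\<Sum>i\<le>n. a i * u ^ i)\<bar> < e" if e: "e > 0" for e
  proof -
    obtain g where g: "real_polynomial_function g" "\<And>u. u \<in> {0..1} \<Longrightarrow> \<bar>q u - g u\<bar> < e"
      using Stone_Weierstrass_real_polynomial_function[OF compact_Icc \<open>continuous_on {0..1} q\<close> e]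
      by metis
    then show ?thesis unfolding real_polynomial_function_iff_sum by blast
  qed
  define E where "E = (LBINT s:{..0}. exp (1 * s :: real))"
  have intE: "set_integrable lborel {..0} (\<lambda>s. exp s :: real)"
    using set_integrable_exp_atMost_0[of 1] by simp
  have int: "set_integrable lborel {..0} (\<lambda>s. \<theta> s * \<Psi> s)"
    if "continuous_on {..0} \<theta>" "\<And>s. s \<le> 0 \<Longrightarrow> \<bar>\<theta> s\<bar> \<le> K" for \<theta> :: "real \<Rightarrow> real" and K
  proof (rule set_integrable_bound)
    show "set_integrable lborel {..0} (\<lambda>s. (K * C) * exp s)"
      using intE by (rule set_integrable_mult_right)
    show "set_borel_measurable lborel {..0} (\<lambda>s. \<theta> s * \<Psi> s)"
      using borel_measurable_continuous_on_indicator[of "{..0}" "\<lambda>s. \<theta> s * \<Psi> s"] that(1) cont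
      by (simp add: set_borel_measurable_def continuous_on_mult)
    have "\<bar>\<theta> s * \<Psi> s\<bar> \<le> \<bar>(K * C) * exp s\<bar>" if "s \<le> 0" for s
    proof -
      have "\<bar>\<theta> s * \<Psi> s\<bar> \<le> K * (C * exp s)"
        unfolding abs_mult using bd \<open>s \<le> 0\<close> \<open>\<And>s. s \<le> 0 \<Longrightarrow> \<bar>\<theta> s\<bar> \<le> K\<close>
        by (intro mult_mono) (auto intro: order_trans[OF abs_ge_zero])
      then show ?thesis by (simp add: mult.assoc)
    qed
    then show "AE s in lborel. s \<in> {..0} \<longrightarrow> norm (\<theta> s * \<Psi> s) \<le> norm (K * C * exp s)" by auto
  qed
  have \<Psi>_C: "\<bar>\<Psi> s\<bar> \<le> C" if "s \<le> 0" for s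
  proof -
    have "C * exp s \<le> C * 1" using that C by (intro mult_left_mono) auto
    then show ?thesis using bd[OF that] by simp
  qed
  define I where "I = (LBINT s:{..0}. \<Psi> s * \<Psi> s)"
  have intI: "set_integrable lborel {..0} (\<lambda>s. \<Psi> s * \<Psi> s)"
    using int[OF cont \<Psi>_C] by simp
  \<comment> \<open>A polynomial in \<open>exp s\<close> is orthogonal to \<open>\<Psi>\<close>, so
    one factor of the square may be replaced by its approximation error, while the other supplies an
    integrable majorant.\<close>
  have I_le: "I \<le> e * (C * E)" if e: "e > 0" for e
  proof -
    obtain n a where na: "\<And>u. u \<in> {0..1} \<Longrightarrow> \<bar>q u - (\<Sum>i\<le>n. a i * u ^ i)\<bar> < e"
      using approx[OF e] by blast
    define p where "p s = (\<Sum>i\<le>n. a i * exp s ^ i)" for s :: real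
    have intk: "set_integrable lborel {..0} (\<lambda>s. exp s ^ k * \<Psi> s)" for k
      by (rule int[where K=1]) (auto intro!: continuous_intros power_le_one)
    have intp: "set_integrable lborel {..0} (\<lambda>s. p s * \<Psi> s)"
    proof (rule int[where K="\<Sum>i\<le>n. \<bar>a i\<bar>"])
      show "\<bar>p s\<bar> \<le> (\<Sum>i\<le>n. \<bar>a i\<bar>)" if "s \<le> 0" for s
        unfolding p_def using that
        by (intro order_trans[OF sum_abs] sum_mono) (auto simp: abs_mult intro!: mult_left_le power_le_one)
    qed (auto simp: p_def intro!: continuous_intros)
    have "(LBINT s:{..0}. p s * \<Psi> s) = (\<Sum>i\<le>n. LBINT s:{..0}. a i * (exp s ^ i * \<Psi> s))"
      unfolding p_def sum_distrib_right mult.assoc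
      by (rule set_integral_sum) (auto intro: set_integrable_mult_right intk)
    also have "\<dots> = 0" by (simp add: zero)
    finally have "I = (LBINT s:{..0}. \<Psi> s * \<Psi> s - p s * \<Psi> s)"
      using set_integral_diff(2)[OF intI intp] by (simp add: I_def)
    also have "\<dots> \<le> (LBINT s:{..0}. (e * C) * exp s)"
    proof (rule set_integral_mono)
      fix s :: real assume "s \<in> {..0}"
      then have "\<bar>\<Psi> s - p s\<bar> \<le> e"
        using na[of "exp s"] q_exp[of s] by (simp add: p_def)
      then have "\<bar>\<Psi> s - p s\<bar> * \<bar>\<Psi> s\<bar> \<le> e * (C * exp s)"
        using bd \<open>s \<in> {..0}\<close> \<open>e > 0\<close> by (intro mult_mono) auto
      then show "\<Psi> s * \<Psi> s - p s * \<Psi> s \<le> (e * C) * exp s"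
        by (simp add: algebra_simps flip: abs_mult)
    qed (use set_integral_diff(1)[OF intI intp] set_integrable_mult_right[OF intE] in auto)
    also have "\<dots> = e * (C * E)" by (simp add: E_def)
    finally show ?thesis .
  qed
  have "I \<le> 0"
  proof (rule ccontr)
    assume "\<not> I \<le> 0"
    have "E \<ge> 0" unfolding E_def set_lebesgue_integral_def by (rule Bochner_Integration.integral_nonneg) simp
    then have CE: "C * E \<ge> 0" using C by simp
    \<comment> \<open>With this choice of \<open>e\<close> the right-hand side is below
      \<open>I\<close>.\<close>
    have "I \<le> I / (2 * (C * E + 1)) * (C * E)"
      using \<open>\<not> I \<le> 0\<close> CE by (intro I_le) auto
    moreover have "C * E * I \<ge> 0" using \<open>\<not> I \<le> 0\<close> CE by simp
    ultimately show False using \<open>\<not> I \<le> 0\<close> CE by (simp add: field_simps)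
  qed
  \<comment> \<open>The interval must contain \<open>s0\<close> and have positive length, even for
    \<open>s0 = 0\<close>.\<close>
  define a where "a = s0 - 1"
  have a: "a < 0" "s0 \<in> {a..0}" using \<open>s0 \<le> 0\<close> by (auto simp: a_def)
  have cont': "continuous_on {a..0} (\<lambda>s. \<Psi> s * \<Psi> s)"
    by (intro continuous_intros continuous_on_subset[OF cont]) auto
  have int': "set_integrable lborel {a..0} (\<lambda>s. \<Psi> s * \<Psi> s)"
    using borel_integrable_atLeastAtMost'[OF cont'] .
  have "integral {a..0} (\<lambda>s. \<Psi> s * \<Psi> s) = (LBINT s:{a..0}. \<Psi> s * \<Psi> s)"
    using set_borel_integral_eq_integral(2)[OF int'] by simp
  also have "\<dots> \<le> I"
    using int' intI unfolding I_def set_lebesgue_integral_def set_integrable_def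
    by (rule integral_mono) (auto simp: indicator_def)
  finally have "integral {a..0} (\<lambda>s. \<Psi> s * \<Psi> s) \<le> 0" using \<open>I \<le> 0\<close> by simp
  moreover have "integral {a..0} (\<lambda>s. \<Psi> s * \<Psi> s) \<ge> 0"
    by (rule integral_nonneg) (auto intro: integrable_continuous_interval cont')
  ultimately have "\<forall>s\<in>{a..0}. \<Psi> s * \<Psi> s = 0"
    using integral_eq_0_iff[OF cont' a(1)] by auto
  then show ?thesis using a by auto
qed

text \<open>The points \<open>z = l - 1 - k\<close> for natural \<open>k\<close> suffice. There the
  transform is the integral of \<open>exp s ^ k\<close> against \<open>\<Psi>\<close>, that is
  \<open>\<phi>\<close> weighted by \<open>exp ((1 - l) * s)\<close>, and this weight normalises the
  bound to \<open>C * exp s\<close>.\<close>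

lemma laplace_eq_0_imp_eq_0:
  assumes cont: "continuous_on {..0} \<phi>" and bd: "\<And>s. s \<le> 0 \<Longrightarrow> norm (\<phi> s) \<le> C * exp (l * s)"
    and zero: "\<And>z. Re z < l \<Longrightarrow> laplace \<phi> z = 0" and "s0 \<le> 0"
  shows "\<phi> s0 = 0"
proof -
  have \<phi>: "exp_bounded l C \<phi>" using cont bd by (rule exp_bounded_continuous)
  define \<Psi> where "\<Psi> s = of_real (exp ((1 - l) * s)) * \<phi> s" for s
  have cont\<Psi>: "continuous_on {..0} \<Psi>"
    unfolding \<Psi>_def by (intro continuous_intros cont)
  have bd\<Psi>: "norm (\<Psi> s) \<le> C * exp s" if "s \<le> 0" for s
  proof -
    have "norm (\<Psi> s) \<le> exp ((1 - l) * s) * (C * exp (l * s))"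
      using bd[OF that] by (simp add: \<Psi>_def norm_mult)
    also have "\<dots> = C * exp s" by (simp add: algebra_simps flip: exp_add)
    finally show ?thesis .
  qed
  have eq: "exp (- (of_real (l - 1 - real k) * of_real s)) * \<phi> s = of_real (exp s ^ k) * \<Psi> s" for k s
  proof -
    have "exp s ^ k * exp ((1 - l) * s) = exp (- ((l - 1 - real k) * s))"
      by (simp add: algebra_simps flip: exp_of_nat_mult exp_add)
    then have "exp (- (of_real (l - 1 - real k) * of_real s)) = complex_of_real (exp s ^ k * exp ((1 - l) * s))"
      by (metis exp_of_real of_real_minus of_real_mult)
    then show ?thesis by (simp only: \<Psi>_def of_real_mult mult.assoc)
  qed
  have int: "set_integrable lborel {..0} (\<lambda>s. of_real (exp s ^ k) * \<Psi> s)" for k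
    using laplace_integrable[OF \<phi>, of "of_real (l - 1 - real k)"] unfolding eq by simp
  have "(LBINT s:{..0}. of_real (exp s ^ k) * \<Psi> s) = 0" for k
    using zero[of "of_real (l - 1 - real k)"] unfolding laplace_def eq by simp
  then have "(LBINT s:{..0}. Re (of_real (exp s ^ k) * \<Psi> s)) = 0"
    "(LBINT s:{..0}. Im (of_real (exp s ^ k) * \<Psi> s)) = 0" for k
    using integral_Re[OF int[of k, unfolded set_integrable_def]]
      integral_Im[OF int[of k, unfolded set_integrable_def]]
    unfolding set_lebesgue_integral_def by auto
  then have "(LBINT s:{..0}. exp s ^ k * Re (\<Psi> s)) = 0" "(LBINT s:{..0}. exp s ^ k * Im (\<Psi> s)) = 0" for k
    by (simp_all flip: of_real_power)
  then have "Re (\<Psi> s0) = 0" "Im (\<Psi> s0) = 0"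
    using exponential_moments_eq_0[of "\<lambda>s. Re (\<Psi> s)" C s0]
      exponential_moments_eq_0[of "\<lambda>s. Im (\<Psi> s)" C s0]
      order_trans[OF abs_Re_le_cmod bd\<Psi>] order_trans[OF abs_Im_le_cmod bd\<Psi>] \<open>s0 \<le> 0\<close>
      continuous_on_Re[OF cont\<Psi>] continuous_on_Im[OF cont\<Psi>]
    by blast+
  then have "\<Psi> s0 = 0" by (simp add: complex_eq_iff)
  then show ?thesis by (simp add: \<Psi>_def)
qed

section \<open>Autonomous differential equations with locally Lipschitz right-hand side\<close>

lemma locally_lipschitzE:
  assumes "locally_lipschitz f"
  obtains r L where "r > 0" "L \<ge> 0" "L-lipschitz_on (cball x r) f"
proof -
  obtain r L where "r > 0" "\<forall>t\<in>cball (0::real) r \<inter> UNIV. L-lipschitz_on (cball x r \<inter> UNIV) f"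
    using assms unfolding local_lipschitz_def by blast
  then have "L-lipschitz_on (cball x r) f" by (metis centre_in_cball inf_top_right less_imp_le)
  then show ?thesis using that \<open>r > 0\<close> lipschitz_on_nonneg by blast
qed

lemma locally_lipschitz_continuous_on:
  assumes "locally_lipschitz f"
  shows "continuous_on S f"
  using local_lipschitz_continuous_on[OF assms] continuous_on_subset by blast

lemma locally_lipschitz_scaleR:
  fixes f :: "'a::metric_space \<Rightarrow> 'b::real_normed_vector" and \<kappa> :: "'a \<Rightarrow> real"
  assumes "locally_lipschitz \<kappa>" "locally_lipschitz f"
  shows "locally_lipschitz (\<lambda>x. \<kappa> x *\<^sub>R f x)"
proof (rule local_lipschitzI)
  fix x :: 'a and t :: real
  obtain r1 K where r1: "r1 > 0" "K \<ge> 0" and K: "K-lipschitz_on (cball x r1) \<kappa>"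
    using assms(1) by (rule locally_lipschitzE)
  obtain r2 L where r2: "r2 > 0" "L \<ge> 0" and L: "L-lipschitz_on (cball x r2) f"
    using assms(2) by (rule locally_lipschitzE)
  define r where "r = min r1 r2"
  have r: "r > 0" "r \<le> r1" "r \<le> r2" using r1 r2 by (auto simp: r_def)
  define A where "A = \<bar>\<kappa> x\<bar> + K * r"
  define B where "B = norm (f x) + L * r"
  have A: "\<bar>\<kappa> y\<bar> \<le> A" if "y \<in> cball x r" for y
  proof -
    have "\<bar>\<kappa> y - \<kappa> x\<bar> \<le> K * dist y x"
      using lipschitz_onD[OF K, of y x] that r by (simp add: dist_real_def)
    also have "\<dots> \<le> K * r" using that r1 by (intro mult_left_mono) (auto simp: dist_commute)
    finally show ?thesis by (simp add: A_def)
  qed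
  have B: "norm (f y) \<le> B" if "y \<in> cball x r" for y
  proof -
    have "norm (f y - f x) \<le> L * dist y x"
      using lipschitz_onD[OF L, of y x] that r by (simp add: dist_norm)
    also have "\<dots> \<le> L * r" using that r2 by (intro mult_left_mono) (auto simp: dist_commute)
    finally show ?thesis using norm_triangle_ineq2[of "f y" "f x"] by (simp add: B_def)
  qed
  have "(A * L + K * B)-lipschitz_on (cball x r) (\<lambda>x. \<kappa> x *\<^sub>R f x)"
  proof (rule lipschitz_onI)
    fix y z assume yz: "y \<in> cball x r" "z \<in> cball x r"
    have "\<kappa> y *\<^sub>R f y - \<kappa> z *\<^sub>R f z = \<kappa> y *\<^sub>R (f y - f z) + (\<kappa> y - \<kappa> z) *\<^sub>R f z"
      by (simp add: algebra_simps)
    then have "norm (\<kappa> y *\<^sub>R f y - \<kappa> z *\<^sub>R f z) \<le> \<bar>\<kappa> y\<bar> * norm (f y - f z) + \<bar>\<kappa> y - \<kappa> z\<bar> * norm (f z)"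
      using norm_triangle_ineq[of "\<kappa> y *\<^sub>R (f y - f z)" "(\<kappa> y - \<kappa> z) *\<^sub>R f z"] by simp
    also have "\<dots> \<le> A * (L * dist y z) + (K * dist y z) * B"
      using lipschitz_onD[OF K, of y z] lipschitz_onD[OF L, of y z] A B yz r r1 r2
        order_trans[OF abs_ge_zero A[OF yz(1)]]
      by (intro add_mono mult_mono) (auto simp: dist_norm)
    finally show "dist (\<kappa> y *\<^sub>R f y) (\<kappa> z *\<^sub>R f z) \<le> (A * L + K * B) * dist y z"
      by (simp add: dist_norm algebra_simps)
  next
    have "0 \<le> A" "0 \<le> B" using r1 r2 r by (auto simp: A_def B_def)
    then show "0 \<le> A * L + K * B" using r1 r2 by simp
  qed
  then show "\<exists>u>0. \<exists>L. \<forall>t\<in>cball t u \<inter> UNIV. L-lipschitz_on (cball x u \<inter> UNIV) (\<lambda>x. \<kappa> x *\<^sub>R f x)"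
    using r by auto
qed

section \<open>Uniqueness of solutions\<close>

lemma vector_derivative_bound:
  fixes u :: "real \<Rightarrow> 'a::real_normed_vector"
  assumes "convex S" "\<And>t. t \<in> S \<Longrightarrow> (u has_vector_derivative u' t) (at t)"
    "\<And>t. t \<in> S \<Longrightarrow> norm (u' t) \<le> B" "s \<in> S" "t \<in> S"
  shows "norm (u s - u t) \<le> B * \<bar>s - t\<bar>"
proof -
  have "norm (u s - u t) \<le> B * norm (s - t)"
  proof (rule differentiable_bound[OF assms(1)])
    show "(u has_derivative (\<lambda>h. h *\<^sub>R u' r)) (at r within S)" if "r \<in> S" for r
      using assms(2)[OF that] has_derivative_at_withinI unfolding has_vector_derivative_def by blast
    show "onorm (\<lambda>h. h *\<^sub>R u' r) \<le> B" if "r \<in> S" for r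
      using assms(3)[OF that] mult_left_mono[OF assms(3)[OF that] abs_ge_zero]
      by (intro onorm_bound) (auto simp: mult.commute intro: order_trans[OF norm_ge_zero])
  qed (use assms in auto)
  then show ?thesis by simp
qed

text \<open>On an interval of radius \<open>1 / (2 L)\<close> the largest distance of the two solutions is at most
  half of itself; hence the set where they agree is open.\<close>

lemma ode_unique:
  fixes f :: "'a::real_normed_vector \<Rightarrow> 'a"
  assumes f: "locally_lipschitz f" and I: "open I" "is_interval I"
    and u: "\<And>t. t \<in> I \<Longrightarrow> (u has_vector_derivative f (u t)) (at t)"
    and v: "\<And>t. t \<in> I \<Longrightarrow> (v has_vector_derivative f (v t)) (at t)"
    and "t0 \<in> I" "u t0 = v t0" "t \<in> I"
  shows "u t = v t"
proof -
  have cu: "continuous_on I u" and cv: "continuous_on I v"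
    using u v by (auto simp: continuous_on_eq_continuous_at I(1) intro: has_vector_derivative_continuous)
  define A where "A = {t \<in> I. u t = v t}"
  have "closedin (top_of_set I) A"
    using continuous_closedin_preimage_constant[of I "\<lambda>t. u t - v t" 0] cu cv
    by (simp add: A_def continuous_on_diff)
  moreover have "open A"
    unfolding open_contains_cball
  proof
    fix s assume s: "s \<in> A"
    obtain r L where r: "r > 0" "L \<ge> 0" and L: "L-lipschitz_on (cball (u s) r) f"
      using f by (rule locally_lipschitzE)
    have s': "s \<in> I" "u s = v s" using s by (auto simp: A_def)
    obtain e0 where e0: "e0 > 0" "cball s e0 \<subseteq> I"
      using I s' by (meson open_contains_cball)
    have "isCont u s" "isCont v s" using cu cv s' I by (auto simp: continuous_on_eq_continuous_at)
    then obtain e1 e2 where e1: "e1 > 0" "\<And>t. dist s t < e1 \<Longrightarrow> dist (u s) (u t) < r"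
      and e2: "e2 > 0" "\<And>t. dist s t < e2 \<Longrightarrow> dist (u s) (v t) < r"
      using r s' unfolding continuous_at_eps_delta by (metis dist_commute)
    \<comment> \<open>\<open>L + 1\<close> avoids division by zero; the halves of \<open>e1\<close>
      and \<open>e2\<close> keep the closed interval strictly inside the open ones.\<close>
    define e where "e = min (min e0 (1 / (2 * (L + 1)))) (min (e1/2) (e2/2))"
    have e: "e > 0" "e \<le> e0" "e < e1" "e < e2" "e \<le> 1 / (2 * (L + 1))"
      using e0 e1 e2 r by (auto simp: e_def min_less_iff_disj)
    have Le: "L * e \<le> 1/2"
    proof -
      have "L * e \<le> (L + 1) * (1 / (2 * (L + 1)))" using r e by (intro mult_mono) auto
      also have "\<dots> = 1/2" using r by (simp add: field_simps)
      finally show ?thesis .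
    qed
    have sub: "cball s e \<subseteq> I" using e0 e by force
    have near: "u t \<in> cball (u s) r" "v t \<in> cball (u s) r" if "t \<in> cball s e" for t
      using e1(2)[of t] e2(2)[of t] that e by auto
    have "continuous_on (cball s e) (\<lambda>t. norm (u t - v t))"
      using cu cv sub by (intro continuous_intros) (auto elim: continuous_on_subset)
    then obtain t1 where t1: "t1 \<in> cball s e" and max: "\<And>t. t \<in> cball s e \<Longrightarrow> norm (u t - v t) \<le> norm (u t1 - v t1)"
      using continuous_attains_sup[of "cball s e" "\<lambda>t. norm (u t - v t)"] e by fastforce
    define m where "m = norm (u t1 - v t1)"
    have "norm ((u t1 - v t1) - (u s - v s)) \<le> (L * m) * \<bar>t1 - s\<bar>"
    proof (rule vector_derivative_bound[of "cball s e" _ "\<lambda>t. f (u t) - f (v t)"])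
      show "((\<lambda>t. u t - v t) has_vector_derivative f (u t) - f (v t)) (at t)" if "t \<in> cball s e" for t
        using u v sub that by (intro has_vector_derivative_diff) auto
      show "norm (f (u t) - f (v t)) \<le> L * m" if "t \<in> cball s e" for t
      proof -
        have "norm (f (u t) - f (v t)) \<le> L * norm (u t - v t)"
          using lipschitz_onD[OF L near[OF that]] by (simp add: dist_norm)
        also have "\<dots> \<le> L * m" using max[OF that] r by (auto simp: m_def intro: mult_left_mono)
        finally show ?thesis .
      qed
    qed (use t1 e in auto)
    also have "\<dots> \<le> (L * m) * e"
      using t1 r by (intro mult_left_mono) (auto simp: dist_real_def m_def)
    also have "\<dots> \<le> m / 2" using mult_right_mono[OF Le, of m] by (simp add: m_def algebra_simps)
    finally have "m = 0" using s' by (simp add: m_def)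
    then have "cball s e \<subseteq> A" using max sub by (auto simp: A_def m_def)
    then show "\<exists>e>0. cball s e \<subseteq> A" using e by blast
  qed
  then have "openin (top_of_set I) A" by (metis A_def I(1) mem_Collect_eq open_openin_trans subsetI)
  moreover have "connected I" using I by (simp add: is_interval_connected_1)
  ultimately have "A = {} \<or> A = I" by (auto simp: connected_clopen)
  then show ?thesis using assms by (auto simp: A_def)
qed

lemma solves_in_unique:
  assumes "locally_lipschitz f" "solves_in f U x J u" "solves_in f V x K v" "t \<in> J" "t \<in> K"
  shows "u t = v t"
  using assms ode_unique[of f "J \<inter> K" u v 0 t]
  by (auto simp: solves_in_def open_Int is_interval_Int)

text \<open>The change of field from \<open>f\<close> to \<open>g\<close> serves to pass to the
  cut-off system where the cut-off is 1.\<close>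

lemma solves_in_subset:
  assumes "solves_in f U x J u" "open K" "is_interval K" "0 \<in> K" "K \<subseteq> J" "u ` K \<subseteq> V"
    "\<And>y. y \<in> V \<Longrightarrow> f y = g y"
  shows "solves_in g V x K u"
  using assms unfolding solves_in_def by (metis image_subset_iff subset_iff)

lemma solves_in_UNIV: "solves_in f U x J u \<Longrightarrow> solves_in f UNIV x J u"
  by (simp add: solves_in_def)

lemma solves_in_continuous: "solves_in f U x J u \<Longrightarrow> continuous_on J u"
  unfolding solves_in_def
  by (auto simp: continuous_on_eq_continuous_at intro: has_vector_derivative_continuous)

section \<open>Maximal solutions and their left endpoint\<close>

lemma mem_max_interval: "t \<in> max_interval f U x \<longleftrightarrow> (\<exists>J u. solves_in f U x J u \<and> t \<in> J)"
  by (auto simp: max_interval_def)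

lemma flow_eq:
  assumes "locally_lipschitz f" "solves_in f UNIV x J u" "t \<in> J"
  shows "flow f x t = u t"
  unfolding flow_def
  by (rule the_equality) (use assms solves_in_unique in blast)+

lemma max_interval_open_interval:
  shows "open (max_interval f U x)" "is_interval (max_interval f U x)"
proof -
  show "open (max_interval f U x)" by (auto simp: max_interval_def solves_in_def)
  have "connected (max_interval f U x)"
    unfolding max_interval_def
    by (rule connected_Union) (auto simp: solves_in_def is_interval_connected_1)
  then show "is_interval (max_interval f U x)" by (simp add: is_interval_connected_1)
qed

text \<open>Solutions from \<open>x\<close> agree on overlaps, so \<open>flow\<close> glues them.
  Existence is the assumption \<open>ne\<close>: the space need not be complete, and a local
  Lipschitz condition alone would not give it.\<close>

lemma solves_in_max_interval:
  assumes f: "locally_lipschitz f" and ne: "max_interval f UNIV x \<noteq> {}"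
  shows "solves_in f UNIV x (max_interval f UNIV x) (flow f x)"
  unfolding solves_in_def
proof (intro conjI ballI)
  obtain J u where "solves_in f UNIV x J u" using ne by (auto simp: max_interval_def)
  then have "0 \<in> J" "u 0 = x" "flow f x 0 = u 0"
    using flow_eq[OF f] by (auto simp: solves_in_def)
  then show "0 \<in> max_interval f UNIV x" "flow f x 0 = x"
    using \<open>solves_in f UNIV x J u\<close> by (auto simp: mem_max_interval)
  fix t assume "t \<in> max_interval f UNIV x"
  then obtain J u where J: "solves_in f UNIV x J u" "t \<in> J" by (auto simp: mem_max_interval)
  then have "(u has_vector_derivative f (u t)) (at t)" "open J" by (auto simp: solves_in_def)
  moreover have "u s = flow f x s" if "s \<in> J" for s using flow_eq[OF f J(1) that] by simp
  ultimately show "(flow f x has_vector_derivative f (flow f x t)) (at t)"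
    using has_vector_derivative_transform_within_open[of u _ t J "flow f x"] \<open>t \<in> J\<close> by simp
qed (simp_all add: max_interval_open_interval)

lemma sigma_minus_le: "solves_in f U x J u \<Longrightarrow> t \<in> J \<Longrightarrow> sigma_minus f U x \<le> ereal t"
  unfolding sigma_minus_def by (rule Inf_lower) (use mem_max_interval in blast)

text \<open>A point below \<open>t\<close> lies in the domain of one single solution, an interval
  containing 0; so no gluing, hence no uniqueness, is involved.\<close>

lemma sigma_minus_less_imp_solution:
  assumes "sigma_minus f U x < ereal t" "t \<le> 0"
  obtains J u where "solves_in f U x J u" "{t..0} \<subseteq> J"
proof -
  obtain s where s: "s \<in> max_interval f U x" "s < t"
    using assms(1) unfolding sigma_minus_def Inf_less_iff by auto
  then obtain J u where J: "solves_in f U x J u" "s \<in> J" by (auto simp: mem_max_interval)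
  have "{t..0} \<subseteq> J"
  proof
    fix r assume "r \<in> {t..0}"
    then show "r \<in> J" using J s mem_is_interval_1_I[of J s 0 r] by (auto simp: solves_in_def)
  qed
  then show ?thesis using that J by blast
qed

section \<open>Changes of time\<close>

lemma open_interval_antiderivative:
  fixes g :: "real \<Rightarrow> real"
  assumes J: "open J" "is_interval J" and g: "continuous_on J g"
  obtains G where "G 0 = 0" "\<And>t. t \<in> J \<Longrightarrow> (G has_real_derivative g t) (at t)"
proof (cases "J = {}")
  case False
  define a b where "a = Inf (ereal ` J)" and "b = Sup (ereal ` J)"
  have J_eq: "t \<in> J \<longleftrightarrow> a < ereal t \<and> ereal t < b" for t
  proof
    assume "t \<in> J"
    then obtain e where e: "e > 0" "cball t e \<subseteq> J" using J(1) by (meson open_contains_cball)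
    then have "t - e \<in> J" "t + e \<in> J" by (auto simp: dist_real_def)
    then have "a \<le> ereal (t - e)" "ereal (t + e) \<le> b"
      by (auto simp: a_def b_def intro: Inf_lower Sup_upper)
    moreover have "ereal (t - e) < ereal t" "ereal t < ereal (t + e)" using e by auto
    ultimately show "a < ereal t \<and> ereal t < b" using order.strict_trans1 order.strict_trans2 by blast
  next
    assume "a < ereal t \<and> ereal t < b"
    then obtain r s where "r \<in> J" "s \<in> J" "r < t" "t < s"
      by (auto simp: a_def b_def Inf_less_iff less_Sup_iff)
    then show "t \<in> J" using J(2) mem_is_interval_1_I[of J r s t] by auto
  qed
  have "a < b" using False J_eq by (metis all_not_in_conv order.strict_trans)
  moreover have "isCont g t" if "a < ereal t" "ereal t < b" for t
    using that J(1) J_eq g by (auto simp: continuous_on_eq_continuous_at)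
  ultimately obtain G where G: "\<forall>t. a < ereal t \<longrightarrow> ereal t < b \<longrightarrow> (G has_vector_derivative g t) (at t)"
    using einterval_antiderivative[of a b g] by blast
  have "((\<lambda>t. G t - G 0) has_real_derivative g t) (at t)" if "t \<in> J" for t
  proof -
    have "(G has_real_derivative g t) (at t)"
      using G J_eq that by (simp add: has_real_derivative_iff_has_vector_derivative)
    then show ?thesis by (auto intro!: derivative_eq_intros)
  qed
  then show ?thesis using that[of "\<lambda>t. G t - G 0"] by simp
qed (use that[of "\<lambda>_. 0"] in auto)

lemma pos_derivative_less:
  fixes \<tau> :: "real \<Rightarrow> real"
  assumes "is_interval J" "\<And>t. t \<in> J \<Longrightarrow> (\<tau> has_real_derivative \<tau>' t) (at t)"
    "\<And>t. t \<in> J \<Longrightarrow> \<tau>' t > 0" "s \<in> J" "t \<in> J" "s < t"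
  shows "\<tau> s < \<tau> t"
proof (rule DERIV_pos_imp_increasing[OF \<open>s < t\<close>])
  fix r assume "s \<le> r" "r \<le> t"
  then have "r \<in> J" using mem_is_interval_1_I[OF assms(1,4,5)] by simp
  then show "\<exists>y. (\<tau> has_real_derivative y) (at r) \<and> 0 < y" using assms(2,3) by blast
qed

text \<open>The new clock \<open>\<tau>\<close> runs at speed \<open>\<rho>\<close> along the
  solution, and \<open>v\<close> is \<open>u\<close> read on that clock; the chain rule divides the
  field by \<open>\<rho>\<close>. It is used with speed \<open>\<kappa>\<close> to leave the cut-off
  system and with speed \<open>1 / \<kappa>\<close> to return to it.\<close>

lemma solves_in_reparametrise:
  assumes sol: "solves_in g U x J u"
    and \<rho>: "continuous_on J (\<lambda>t. \<rho> (u t))" "\<And>t. t \<in> J \<Longrightarrow> \<rho> (u t) > 0"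
    and g: "\<And>t. t \<in> J \<Longrightarrow> g (u t) = \<rho> (u t) *\<^sub>R k (u t)"
  obtains \<tau> v where "\<tau> 0 = 0" "\<And>t. t \<in> J \<Longrightarrow> (\<tau> has_real_derivative \<rho> (u t)) (at t)"
    "solves_in k U x (\<tau> ` J) v" "\<And>t. t \<in> J \<Longrightarrow> v (\<tau> t) = u t"
proof -
  have J: "open J" "is_interval J" "0 \<in> J" using sol by (auto simp: solves_in_def)
  obtain \<tau> where \<tau>: "\<tau> 0 = 0" "\<And>t. t \<in> J \<Longrightarrow> (\<tau> has_real_derivative \<rho> (u t)) (at t)"
    using open_interval_antiderivative[OF J(1,2) \<rho>(1)] by blast
  have mono: "\<tau> s < \<tau> t" if "s \<in> J" "t \<in> J" "s < t" for s t
    using pos_derivative_less[OF J(2) \<tau>(2) \<rho>(2)] that by blast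
  then have inj: "inj_on \<tau> J" by (intro linorder_inj_onI) (auto dest: less_imp_neq)
  have cont: "continuous_on J \<tau>" using \<tau>(2) by (meson DERIV_isCont continuous_at_imp_continuous_on)
  define \<theta> where "\<theta> = inv_into J \<tau>"
  have \<theta>: "\<theta> (\<tau> t) = t" if "t \<in> J" for t using inj that by (simp add: \<theta>_def)
  define v where "v = u \<circ> \<theta>"
  have v: "v (\<tau> t) = u t" if "t \<in> J" for t using \<theta> that by (simp add: v_def)
  have "solves_in k U x (\<tau> ` J) v"
    unfolding solves_in_def
  proof (intro conjI ballI)
    show "open (\<tau> ` J)" using invariance_of_domain[OF cont J(1) inj] .
    show "is_interval (\<tau> ` J)"
      using connected_continuous_image[OF cont] J(2) by (simp add: is_interval_connected_1)
    show "0 \<in> \<tau> ` J" using J(3) \<tau>(1) by force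
    show "v 0 = x" using v[OF J(3)] \<tau>(1) sol by (simp add: solves_in_def)
    fix s assume "s \<in> \<tau> ` J"
    then obtain t where t: "t \<in> J" "s = \<tau> t" by blast
    show "v s \<in> U" using v[OF t(1)] t sol by (simp add: solves_in_def)
    have "(\<theta> has_derivative (\<lambda>h. h / \<rho> (u t))) (at (\<tau> t))"
    proof (rule has_derivative_inverse_strong[OF J(1) t(1) cont])
      show "(\<tau> has_derivative (*) (\<rho> (u t))) (at t)"
        using \<tau>(2)[OF t(1)] by (simp add: has_field_derivative_def)
      show "(*) (\<rho> (u t)) \<circ> (\<lambda>h. h / \<rho> (u t)) = id"
        using \<rho>(2)[OF t(1)] by auto
    qed (rule \<theta>)
    then have "(\<theta> has_vector_derivative 1 / \<rho> (u t)) (at s)"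
      by (simp add: has_vector_derivative_def t)
    moreover have "(u has_vector_derivative g (u t)) (at (\<theta> s))"
      using sol t \<theta> by (simp add: solves_in_def)
    ultimately have "(v has_vector_derivative (1 / \<rho> (u t)) *\<^sub>R g (u t)) (at s)"
      unfolding v_def by (rule vector_diff_chain_at)
    moreover have "(1 / \<rho> (u t)) *\<^sub>R g (u t) = k (v s)"
      using g[OF t(1)] \<rho>(2)[OF t(1)] v[OF t(1)] t by simp
    ultimately show "(v has_vector_derivative k (v s)) (at s)" by simp
  qed
  then show ?thesis using that \<tau> v by blast
qed

section \<open>Backward completeness of the cut-off system\<close>

lemma bounded_derivative_near:
  fixes w :: "real \<Rightarrow> 'a::real_normed_vector"
  assumes "open I" "s \<in> I" "\<And>t. t \<in> I \<Longrightarrow> (w has_vector_derivative w' t) (at t)" "continuous_on I w'"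
  obtains d C where "d > 0" "C \<ge> 0" "ball s d \<subseteq> I" "\<And>t. t \<in> ball s d \<Longrightarrow> dist (w t) (w s) \<le> C * \<bar>t - s\<bar>"
proof -
  have "isCont w' s" using assms by (simp add: continuous_on_eq_continuous_at)
  then obtain d1 where d1: "d1 > 0" "\<And>t. dist t s < d1 \<Longrightarrow> dist (w' t) (w' s) < 1"
    unfolding continuous_at_eps_delta by (metis zero_less_one)
  obtain d2 where d2: "d2 > 0" "ball s d2 \<subseteq> I" using assms by (meson openE)
  define d where "d = min d1 d2"
  have d: "d > 0" "ball s d \<subseteq> I" using d1 d2 by (auto simp: d_def)
  have "norm (w' t) \<le> norm (w' s) + 1" if "t \<in> ball s d" for t
    using d1(2)[of t] that norm_triangle_ineq2[of "w' t" "w' s"]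
    by (auto simp: d_def dist_norm norm_minus_commute abs_minus_commute)
  then have "norm (w t - w s) \<le> (norm (w' s) + 1) * \<bar>t - s\<bar>" if "t \<in> ball s d" for t
    using d that assms(3) by (intro vector_derivative_bound[of "ball s d" w w']) auto
  then show ?thesis using that[of d "norm (w' s) + 1"] d by (simp add: dist_norm)
qed

text \<open>A zero of \<open>\<kappa>\<close> is an equilibrium of the cut-off field, and by
  uniqueness no other solution reaches it.\<close>

lemma solves_in_cut_nonzero:
  assumes c: "locally_lipschitz (cut \<kappa> f)" and sol: "solves_in (cut \<kappa> f) U x N \<phi>"
    and "\<kappa> x \<noteq> 0" "t \<in> N"
  shows "\<kappa> (\<phi> t) \<noteq> 0"
proof
  assume "\<kappa> (\<phi> t) = 0"
  then have "\<phi> 0 = \<phi> t"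
    using sol \<open>t \<in> N\<close>
    by (intro ode_unique[OF c, of N \<phi> "\<lambda>_. \<phi> t" t 0]) (auto simp: solves_in_def)
  then show False using \<open>\<kappa> (\<phi> t) = 0\<close> assms sol by (simp add: solves_in_def)
qed

text \<open>A change of sign along the solution would pass through a zero of
  \<open>\<kappa>\<close>.\<close>

lemma solves_in_cut_pos:
  assumes "locally_lipschitz f" and \<kappa>: "locally_lipschitz \<kappa>" and sol: "solves_in (cut \<kappa> f) U x N \<phi>"
    and "\<kappa> x > 0" "t \<in> N"
  shows "\<kappa> (\<phi> t) > 0"
proof (rule ccontr)
  assume "\<not> \<kappa> (\<phi> t) > 0"
  have N: "is_interval N" "0 \<in> N" "\<phi> 0 = x" using sol by (auto simp: solves_in_def)
  have "continuous_on N (\<lambda>t. \<kappa> (\<phi> t))"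
    by (rule continuous_on_compose2[OF locally_lipschitz_continuous_on[OF \<kappa>, of UNIV]
        solves_in_continuous[OF sol]]) auto
  then have "is_interval ((\<lambda>t. \<kappa> (\<phi> t)) ` N)"
    using connected_continuous_image N(1) is_interval_connected_1 by blast
  then have "0 \<in> (\<lambda>t. \<kappa> (\<phi> t)) ` N"
    using mem_is_interval_1_I[of "(\<lambda>t. \<kappa> (\<phi> t)) ` N" "\<kappa> (\<phi> t)" "\<kappa> (\<phi> 0)" 0]
      \<open>\<not> \<kappa> (\<phi> t) > 0\<close> \<open>\<kappa> x > 0\<close> \<open>t \<in> N\<close> N by auto
  then show False
    using solves_in_cut_nonzero[OF locally_lipschitz_scaleR[OF \<kappa> assms(1)] sol] \<open>\<kappa> x > 0\<close> by auto
qed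

text \<open>The time change \<open>\<tau>\<close> turns the solution of the cut-off system into a solution \<open>w\<close> of the original
  one. If the former escaped at a finite time \<open>a\<close>, then \<open>\<tau>\<close> would tend there to a finite limit
  \<open>\<tau>s\<close>, beyond which \<open>w\<close> extends by backward completeness. If the cut-off is positive at
  \<open>w \<tau>s\<close>, the inverse time change extends the solution of the cut-off system beyond \<open>a\<close>; otherwise
  \<open>\<tau>\<close> reaches \<open>\<tau>s\<close> at most exponentially fast, hence not in finite time.\<close>

proposition cut_backward_complete:
  fixes f :: "'a::real_normed_vector \<Rightarrow> 'a"
  assumes f: "locally_lipschitz f" and \<kappa>: "locally_lipschitz \<kappa>"
    and complete: "backward_complete_within f V"
    and zero: "\<And>y. y \<notin> V \<Longrightarrow> \<kappa> y = 0"
    and W: "open W" "x \<in> W" "\<And>y. y \<in> W \<Longrightarrow> \<kappa> y = 1"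
    and blowup: "no_cutoff_blowup f \<kappa> x"
  shows "sigma_minus (cut \<kappa> f) UNIV x = -\<infinity>"
proof (rule ccontr)
  assume not_minf: "sigma_minus (cut \<kappa> f) UNIV x \<noteq> -\<infinity>"
  have c: "locally_lipschitz (cut \<kappa> f)" by (rule locally_lipschitz_scaleR[OF \<kappa> f])
  have \<kappa>x: "\<kappa> x = 1" using W by simp
  have "x \<in> V" using zero \<kappa>x by force
  \<comment> \<open>Existence comes from backward completeness: without a solution both left
    endpoints are infima of the empty set, that is \<open>\<infinity>\<close>, and the required
    strict inequality fails.\<close>
  have "\<exists>J u. solves_in f UNIV x J u"
  proof (rule ccontr)
    assume "\<nexists>J u. solves_in f UNIV x J u"
    then have "max_interval f UNIV x = {}" "max_interval f V x = {}"
      using solves_in_UNIV by (fastforce simp: max_interval_def)+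
    then have "sigma_minus f V x = \<infinity>" "sigma_minus f UNIV x = \<infinity>"
      by (simp_all add: sigma_minus_def top_ereal_def)
    then show False using complete \<open>x \<in> V\<close> unfolding backward_complete_within_def by force
  qed
  then obtain J u where J: "solves_in f UNIV x J u" by blast
  \<comment> \<open>For short times the solution of \<open>f\<close> stays where
    \<open>\<kappa>\<close> is 1 and so solves the cut-off system too.\<close>
  have "open (J \<inter> u -` W)"
    using continuous_open_preimage[OF solves_in_continuous[OF J] _ W(1)] J by (simp add: solves_in_def)
  moreover have "0 \<in> J \<inter> u -` W" using J W(2) by (simp add: solves_in_def)
  ultimately obtain e1 where e1: "e1 > 0" "ball 0 e1 \<subseteq> J \<inter> u -` W" by (meson openE)
  have "solves_in (cut \<kappa> f) W x (ball 0 e1) u"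
    using e1 W(3) by (intro solves_in_subset[OF J]) (auto simp: is_interval_ball_real)
  then have sol1: "solves_in (cut \<kappa> f) UNIV x (ball 0 e1) u" by (rule solves_in_UNIV)
  define N where "N = max_interval (cut \<kappa> f) UNIV x"
  define \<phi> where "\<phi> = flow (cut \<kappa> f) x"
  have "0 \<in> N" using sol1 e1 by (auto simp: N_def mem_max_interval)
  then have sol: "solves_in (cut \<kappa> f) UNIV x N \<phi>"
    unfolding N_def \<phi>_def by (intro solves_in_max_interval[OF c]) auto
  then have N: "open N" "is_interval N" "\<phi> 0 = x" by (auto simp: solves_in_def)
  obtain a where a: "sigma_minus (cut \<kappa> f) UNIV x = ereal a"
    using not_minf sigma_minus_le[OF sol \<open>0 \<in> N\<close>] by (cases "sigma_minus (cut \<kappa> f) UNIV x") auto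
  have below: "\<exists>s\<in>N. s < t" if t: "t \<in> N" for t
  proof -
    obtain e where "e > 0" "cball t e \<subseteq> N" using N(1) t by (meson open_contains_cball)
    then show ?thesis by (intro bexI[of _ "t - e"]) (auto simp: dist_real_def)
  qed
  have aN: "a < t" if "t \<in> N" for t
    using below[OF that] sigma_minus_le[OF sol] a by fastforce
  have N0: "t \<in> N" if "a < t" "t \<le> 0" for t
  proof -
    have "sigma_minus (cut \<kappa> f) UNIV x < ereal t" using a that by simp
    then obtain J' u' where "solves_in (cut \<kappa> f) UNIV x J' u'" "{t..0} \<subseteq> J'"
      using sigma_minus_less_imp_solution \<open>t \<le> 0\<close> by blast
    moreover from this have "t \<in> J'" using \<open>t \<le> 0\<close> by auto
    ultimately show ?thesis unfolding N_def mem_max_interval by blast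
  qed
  have "a < 0" using aN \<open>0 \<in> N\<close> by blast
  have pos: "\<kappa> (\<phi> t) > 0" if "t \<in> N" for t
    using solves_in_cut_pos[OF f \<kappa> sol _ that] \<kappa>x by simp
  have solV: "solves_in (cut \<kappa> f) V x N \<phi>"
    using sol pos zero unfolding solves_in_def by (metis less_irrefl)
  \<comment> \<open>This is where \<open>blowup\<close> is used: a clock of speed at most
    \<open>K\<close> reads at least \<open>K * a\<close> during the finite span down to
    \<open>a\<close>.\<close>
  obtain K where K: "K > 0" "\<And>t. a < t \<Longrightarrow> t \<le> 0 \<Longrightarrow> \<kappa> (\<phi> t) \<le> K"
  proof -
    have "bounded ((\<lambda>t. \<kappa> (\<phi> t)) ` {t. a < t \<and> t \<le> 0})"
      using blowup a by (simp add: no_cutoff_blowup_def \<phi>_def)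
    then obtain K where "K > 0" "\<forall>y\<in>(\<lambda>t. \<kappa> (\<phi> t)) ` {t. a < t \<and> t \<le> 0}. norm y \<le> K"
      using bounded_pos by metis
    then show ?thesis using that[of K] by fastforce
  qed
  have cont\<kappa>: "continuous_on S (\<lambda>t. \<kappa> (u t))" if "continuous_on S u" for S and u :: "real \<Rightarrow> 'a"
    by (rule continuous_on_compose2[OF locally_lipschitz_continuous_on[OF \<kappa>, of UNIV] that]) auto
  obtain \<tau> v where \<tau>: "\<tau> 0 = 0" "\<And>t. t \<in> N \<Longrightarrow> (\<tau> has_real_derivative \<kappa> (\<phi> t)) (at t)"
    and v: "solves_in f V x (\<tau> ` N) v" "\<And>t. t \<in> N \<Longrightarrow> v (\<tau> t) = \<phi> t"
    using solves_in_reparametrise[OF solV cont\<kappa>[OF solves_in_continuous[OF solV]] pos, of f] by blast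
  have mono: "\<tau> s < \<tau> t" if "s \<in> N" "t \<in> N" "s < t" for s t
    using pos_derivative_less[OF N(2) \<tau>(2) pos] that by blast
  have lower: "K * a \<le> \<tau> t" if "t \<in> N" for t
  proof (cases "t \<ge> 0")
    case True
    then have "0 \<le> \<tau> t" using mono[of 0 t] \<tau>(1) \<open>0 \<in> N\<close> that by (cases "t = 0") auto
    then show ?thesis using K(1) \<open>a < 0\<close> by (smt (verit) mult_pos_neg)
  next
    case False
    have "norm (\<tau> t - \<tau> 0) \<le> K * \<bar>t - 0\<bar>"
    proof (rule vector_derivative_bound[of "{t..0}"])
      fix s assume "s \<in> {t..0}"
      then have s: "a < s" "s \<le> 0" "s \<in> N" using aN[OF that] N0 by auto
      then show "(\<tau> has_vector_derivative \<kappa> (\<phi> s)) (at s)"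
        using \<tau>(2) by (simp add: has_real_derivative_iff_has_vector_derivative)
      show "norm (\<kappa> (\<phi> s)) \<le> K" using K(2) pos s by (simp add: less_imp_le)
    qed (use False in auto)
    then have "K * t \<le> \<tau> t" using \<tau>(1) False by auto
    moreover have "K * a \<le> K * t" using K(1) aN[OF that] by simp
    ultimately show ?thesis by simp
  qed
  define \<tau>s where "\<tau>s = Inf (\<tau> ` N)"
  have bdd: "bdd_below (\<tau> ` N)" using lower by (auto intro!: bdd_belowI[of _ "K * a"])
  have \<tau>s_less: "\<tau>s < \<tau> t" if t: "t \<in> N" for t
  proof -
    obtain s where "s \<in> N" "s < t" using below[OF t] by blast
    then show ?thesis using cInf_lower[OF _ bdd, of "\<tau> s"] mono[of s t] t by (simp add: \<tau>s_def)
  qed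
  have \<tau>s_approx: "\<exists>t\<in>N. \<tau> t < y" if "\<tau>s < y" for y
    using cInf_lessD[of "\<tau> ` N" y] that \<open>0 \<in> N\<close> unfolding \<tau>s_def by blast
  have "\<tau>s < 0" using \<tau>s_less[OF \<open>0 \<in> N\<close>] \<tau>(1) by simp
  have sigV: "sigma_minus f V x \<le> ereal \<tau>s"
  proof (rule ccontr)
    assume "\<not> sigma_minus f V x \<le> ereal \<tau>s"
    then obtain y where "\<tau>s < y" "ereal y < sigma_minus f V x"
      using ereal_dense2[of "ereal \<tau>s" "sigma_minus f V x"] by (auto simp: linorder_not_le)
    then obtain t where "t \<in> N" "\<tau> t < y" using \<tau>s_approx by blast
    then have "sigma_minus f V x \<le> ereal (\<tau> t)" using sigma_minus_le[OF v(1)] by blast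
    also have "\<dots> < ereal y" using \<open>\<tau> t < y\<close> by simp
    finally show False using \<open>ereal y < sigma_minus f V x\<close> by simp
  qed
  have "sigma_minus f UNIV x < ereal \<tau>s"
  proof (cases "sigma_minus f V x = -\<infinity>")
    case True
    then obtain J' u' where "solves_in f V x J' u'" "{\<tau>s - 1..0} \<subseteq> J'"
      using sigma_minus_less_imp_solution[of f V x "\<tau>s - 1"] \<open>\<tau>s < 0\<close> by auto
    then have "sigma_minus f UNIV x \<le> ereal (\<tau>s - 1)"
      using \<open>\<tau>s < 0\<close> by (intro sigma_minus_le[OF solves_in_UNIV]) auto
    also have "\<dots> < ereal \<tau>s" by simp
    finally show ?thesis .
  next
    case False
    then have "sigma_minus f UNIV x < sigma_minus f V x"
      using complete \<open>x \<in> V\<close> by (simp add: backward_complete_within_def)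
    then show ?thesis using sigV by (rule order.strict_trans2)
  qed
  \<comment> \<open>The solution \<open>w\<close> of \<open>f\<close> is defined strictly past
    \<open>\<tau>s\<close>, though it may leave \<open>V\<close> there.\<close>
  then obtain r where r: "sigma_minus f UNIV x < ereal r" "r < \<tau>s"
    using ereal_dense2 by (metis less_ereal.simps(1))
  obtain I w where w: "solves_in f UNIV x I w" and rI: "{r..0} \<subseteq> I"
    using sigma_minus_less_imp_solution[OF r(1)] r(2) \<open>\<tau>s < 0\<close> by (metis less_imp_le order.strict_trans)
  have I: "open I" "is_interval I" "0 \<in> I" "w 0 = x" using w by (auto simp: solves_in_def)
  have contw: "continuous_on I w" by (rule solves_in_continuous[OF w])
  have \<tau>_nonpos: "\<tau> t \<le> 0" if "t \<in> N" "t \<le> 0" for t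
    using mono[of t 0] \<tau>(1) that \<open>0 \<in> N\<close> by (cases "t = 0") auto
  have w\<tau>: "w (\<tau> t) = \<phi> t" if "t \<in> N" "t \<le> 0" for t
  proof -
    have "\<tau> t \<in> I" using \<tau>s_less[OF that(1)] r(2) \<tau>_nonpos[OF that] rI by auto
    then show ?thesis using solves_in_unique[OF f w v(1)] v(2) that by force
  qed
  have range: "\<exists>t\<in>N. t \<le> 0 \<and> \<tau> t = s" if s: "\<tau>s < s" "s \<le> 0" for s
  proof -
    obtain t1 where t1: "t1 \<in> N" "\<tau> t1 < s" using \<tau>s_approx[OF s(1)] by blast
    have "is_interval (\<tau> ` N)" "0 \<in> \<tau> ` N" using v(1) by (auto simp: solves_in_def)
    then have "s \<in> \<tau> ` N" using mem_is_interval_1_I[of "\<tau> ` N" "\<tau> t1" 0 s] t1 s by auto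
    then obtain t where "t \<in> N" "\<tau> t = s" by blast
    moreover have "t \<le> 0" using mono[of 0 t] \<tau>(1) \<open>0 \<in> N\<close> calculation s by force
    ultimately show ?thesis by blast
  qed
  have wpos: "\<kappa> (w s) > 0" if "\<tau>s < s" "s \<le> 0" for s
    using range[OF that] w\<tau> pos by force
  have \<tau>sI: "\<tau>s \<in> I" using rI r \<open>\<tau>s < 0\<close> by auto
  show False
  proof (cases "\<kappa> (w \<tau>s) > 0")
    case True
    have "open (I \<inter> (\<lambda>s. \<kappa> (w s)) -` {0<..})"
      by (rule continuous_open_preimage[OF cont\<kappa>[OF contw] I(1)]) simp
    moreover have "\<tau>s \<in> I \<inter> (\<lambda>s. \<kappa> (w s)) -` {0<..}" "0 \<in> I \<inter> (\<lambda>s. \<kappa> (w s)) -` {0<..}"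
      using True \<tau>sI I \<kappa>x by auto
    ultimately obtain e e' where e: "e > 0" "ball \<tau>s e \<subseteq> I \<inter> (\<lambda>s. \<kappa> (w s)) -` {0<..}"
      and e': "e' > 0" "ball 0 e' \<subseteq> I \<inter> (\<lambda>s. \<kappa> (w s)) -` {0<..}"
      by (meson openE)
    \<comment> \<open>An open interval around all of \<open>[\<tau>s, 0]\<close> on which the
      inverse clock speed \<open>1 / \<kappa>\<close> makes sense.\<close>
    define I' where "I' = {\<tau>s - e<..<e'}"
    have I': "s \<in> I" "\<kappa> (w s) > 0" if "s \<in> I'" for s
    proof -
      consider "s \<le> \<tau>s" | "\<tau>s < s" "s \<le> 0" | "s > 0" by linarith
      then have "s \<in> I \<and> \<kappa> (w s) > 0"
      proof cases
        case 1
        then have "s \<in> ball \<tau>s e" using that by (auto simp: I'_def dist_real_def)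
        then show ?thesis using e by blast
      next
        case 2
        then show ?thesis using wpos rI r by auto
      next
        case 3
        then have "s \<in> ball 0 e'" using that by (auto simp: I'_def)
        then show ?thesis using e' by blast
      qed
      then show "s \<in> I" "\<kappa> (w s) > 0" by auto
    qed
    have I'0: "is_interval I'" "s \<in> I'" if "\<tau>s \<le> s" "s \<le> 0" for s
      using that e e' by (auto simp: I'_def is_interval_oo)
    have solI': "solves_in f UNIV x I' w"
      using I' I'0[of 0] \<open>\<tau>s < 0\<close> by (intro solves_in_subset[OF w]) (auto simp: I'_def)
    have "continuous_on I' (\<lambda>s. 1 / \<kappa> (w s))"
      using I' cont\<kappa>[OF solves_in_continuous[OF solI']] by (intro continuous_intros) force+
    then obtain \<Theta> v2 where \<Theta>: "\<Theta> 0 = 0" "\<And>s. s \<in> I' \<Longrightarrow> (\<Theta> has_real_derivative 1 / \<kappa> (w s)) (at s)"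
      and v2: "solves_in (cut \<kappa> f) UNIV x (\<Theta> ` I') v2"
      using I' by (rule_tac solves_in_reparametrise[OF solI', of "\<lambda>y. 1 / \<kappa> y" "cut \<kappa> f"]) force+
    define b where "b = \<Theta> \<tau>s"
    have "b \<in> N" using v2 I'0[of \<tau>s] \<open>\<tau>s < 0\<close> by (auto simp: b_def N_def mem_max_interval)
    have "a < b" using aN \<open>b \<in> N\<close> by blast
    have \<tau>I': "\<tau> t \<in> I'" if "a < t" "t \<le> 0" for t
      using \<tau>s_less[OF N0] \<tau>_nonpos[OF N0] that by (intro I'0) (auto simp: less_imp_le)
    \<comment> \<open>\<open>\<Theta>\<close> inverts \<open>\<tau>\<close> on this interval. As
      \<open>\<Theta>\<close> increases, \<open>b\<close> then lies below every time of the
      interval, although \<open>b \<in> N\<close> forces \<open>a < b\<close>.\<close>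
    have "((\<lambda>t. \<Theta> (\<tau> t) - t) has_real_derivative 0) (at t within {a<..0})" if t: "t \<in> {a<..0}" for t
    proof -
      have "((\<lambda>t. \<Theta> (\<tau> t)) has_real_derivative (1 / \<kappa> (w (\<tau> t))) * \<kappa> (\<phi> t)) (at t)"
        using t N0 \<tau>I' by (intro DERIV_chain2[OF \<Theta>(2) \<tau>(2)]) auto
      moreover have "(1 / \<kappa> (w (\<tau> t))) * \<kappa> (\<phi> t) = 1"
        using t N0 w\<tau>[of t] pos[of t] by auto
      ultimately have "((\<lambda>t. \<Theta> (\<tau> t) - t) has_real_derivative 0) (at t)"
        by (auto intro!: derivative_eq_intros)
      then show ?thesis by (rule has_field_derivative_at_within)
    qed
    then obtain k where k: "\<And>t. t \<in> {a<..0} \<Longrightarrow> \<Theta> (\<tau> t) - t = k"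
      using has_field_derivative_zero_constant[of "{a<..0}" "\<lambda>t. \<Theta> (\<tau> t) - t"] by auto
    have "k = 0" using k[of 0] \<open>a < 0\<close> \<tau>(1) \<Theta>(1) by simp
    have "b < t" if "a < t" "t \<le> 0" for t
    proof -
      have "\<Theta> \<tau>s < \<Theta> (\<tau> t)"
        using I'0[of \<tau>s] \<open>\<tau>s < 0\<close> \<tau>I'[OF that] \<tau>s_less[OF N0[OF that]] I'
        by (intro pos_derivative_less[of I' \<Theta> "\<lambda>s. 1 / \<kappa> (w s)"] \<Theta>(2)) auto
      then show ?thesis using k[of t] \<open>k = 0\<close> that by (simp add: b_def)
    qed
    from this[of "(a + min b 0) / 2"] show False
      using \<open>a < b\<close> \<open>a < 0\<close> by (cases "b \<le> 0") auto
  next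
    case False
    have contfw: "continuous_on I (\<lambda>s. f (w s))"
      by (rule continuous_on_compose2[OF locally_lipschitz_continuous_on[OF f, of UNIV] contw]) auto
    have wder: "\<And>t. t \<in> I \<Longrightarrow> (w has_vector_derivative f (w t)) (at t)"
      using w by (simp add: solves_in_def)
    obtain d C where d: "d > 0" "C \<ge> 0"
      and C: "\<And>s. s \<in> ball \<tau>s d \<Longrightarrow> dist (w s) (w \<tau>s) \<le> C * \<bar>s - \<tau>s\<bar>"
      using bounded_derivative_near[OF I(1) \<tau>sI wder contfw] by metis
    obtain r2 L where r2: "r2 > 0" "L \<ge> 0" and L: "L-lipschitz_on (cball (w \<tau>s) r2) \<kappa>"
      using \<kappa> by (rule locally_lipschitzE)
    define d' where "d' = min d (r2 / (C + 1))"
    have d': "d' > 0" using d r2 by (simp add: d'_def)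
    \<comment> \<open>Since \<open>\<kappa> (w \<tau>s) \<le> 0\<close>, the Lipschitz constants of
      \<open>\<kappa>\<close> and of \<open>w\<close> bound the clock speed by \<open>Q\<close>
      times the distance still to run.\<close>
    define Q where "Q = L * C"
    have slow: "\<kappa> (w s) \<le> Q * (s - \<tau>s)" if s: "\<tau>s < s" "s < \<tau>s + d'" for s
    proof -
      have dist_w: "dist (w s) (w \<tau>s) \<le> C * (s - \<tau>s)"
        using C[of s] s by (simp add: d'_def dist_real_def)
      also have "\<dots> \<le> (C + 1) * (r2 / (C + 1))"
        using s d by (intro mult_mono) (auto simp: d'_def)
      also have "\<dots> = r2" using d by simp
      finally have "w s \<in> cball (w \<tau>s) r2" by (simp add: dist_commute)
      then have "\<kappa> (w s) - \<kappa> (w \<tau>s) \<le> L * dist (w s) (w \<tau>s)"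
        using lipschitz_onD[OF L, of "w s" "w \<tau>s"] r2 by (simp add: dist_real_def)
      also have "\<dots> \<le> L * (C * (s - \<tau>s))" using dist_w r2 by (intro mult_left_mono)
      finally show ?thesis using False by (simp add: Q_def)
    qed
    have "\<tau>s < min (\<tau>s + d') 0" using d' \<open>\<tau>s < 0\<close> by simp
    then obtain t1 where t1: "t1 \<in> N" "\<tau> t1 < min (\<tau>s + d') 0" using \<tau>s_approx by blast
    have "t1 \<le> 0" using mono[of 0 t1] \<tau>(1) \<open>0 \<in> N\<close> t1 by force
    \<comment> \<open>Gronwall's argument: the integrating factor makes \<open>D\<close>
      nonincreasing, so \<open>D\<close> does not drop below \<open>D t1\<close> as \<open>t\<close>
      runs back to \<open>a\<close>.\<close>
    define D where "D t = (\<tau> t - \<tau>s) * exp (- (Q * t))" for t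
    have decr: "D t1 \<le> D t" if t: "t \<in> N" "t \<le> t1" for t
    proof (rule DERIV_nonpos_imp_nonincreasing[OF t(2)])
      fix s assume s: "t \<le> s" "s \<le> t1"
      have sN: "s \<in> N" "s \<le> 0" using N0[of s] aN[OF t(1)] s \<open>t1 \<le> 0\<close> by auto
      have "\<tau> s \<le> \<tau> t1" using mono[of s t1] sN t1 s by (cases "s = t1") auto
      then have "\<kappa> (\<phi> s) \<le> Q * (\<tau> s - \<tau>s)"
        using slow[of "\<tau> s"] \<tau>s_less[OF sN(1)] t1 w\<tau>[OF sN] by simp
      then have "(\<kappa> (\<phi> s) - Q * (\<tau> s - \<tau>s)) * exp (- (Q * s)) \<le> 0"
        by (simp add: mult_nonpos_nonneg)
      moreover have "(D has_real_derivative (\<kappa> (\<phi> s) - Q * (\<tau> s - \<tau>s)) * exp (- (Q * s))) (at s)"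
        unfolding D_def using \<tau>(2)[OF sN(1)]
        by (auto intro!: derivative_eq_intros simp: algebra_simps)
      ultimately show "\<exists>y. (D has_real_derivative y) (at s) \<and> y \<le> 0" by blast
    qed
    \<comment> \<open>A positive lower bound for \<open>\<tau> t - \<tau>s\<close> at all
      \<open>t \<in> N\<close> up to \<open>t1\<close>, available because \<open>a\<close> is
      finite.\<close>
    define \<eta> where "\<eta> = D t1 * exp (Q * a)"
    have "D t1 > 0" using \<tau>s_less[OF t1(1)] by (simp add: D_def)
    then have "\<eta> > 0" by (simp add: \<eta>_def)
    then obtain t2 where t2: "t2 \<in> N" "\<tau> t2 < \<tau>s + \<eta>" using \<tau>s_approx[of "\<tau>s + \<eta>"] by auto
    define t3 where "t3 = min t1 t2"
    have t3: "t3 \<in> N" "t3 \<le> t1" "t3 \<le> t2" using t1 t2 by (auto simp: t3_def min_def)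
    have "\<eta> \<le> D t3 * exp (Q * t3)"
      unfolding \<eta>_def using decr[OF t3(1,2)] \<open>D t1 > 0\<close> aN[OF t3(1)] r2 d
      by (intro mult_mono) (auto simp: Q_def intro!: mult_left_mono)
    also have "\<dots> = \<tau> t3 - \<tau>s" by (simp add: D_def flip: exp_add)
    also have "\<tau> t3 \<le> \<tau> t2" using mono[of t3 t2] t3 t2 by (cases "t3 = t2") auto
    finally show False using t2 by simp
  qed
qed

section \<open>Diagonal matrices and vector-valued integrals\<close>

lemma sums_vecI:
  fixes f :: "nat \<Rightarrow> 'a::real_normed_vector^'n"
  assumes "\<And>i. (\<lambda>k. f k $ i) sums (L $ i)"
  shows "f sums L"
  unfolding sums_def
  by (rule vec_tendstoI) (use assms in \<open>simp add: sums_def sum_component\<close>)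

lemma diag_matrix_mult_nth: "(diag_matrix v ** B) $ i $ j = v $ i * B $ i $ j"
  by (simp add: diag_matrix_def matrix_matrix_mult_def mult_delta_left)

lemma diag_matrix_power:
  "((**) (diag_matrix v) ^^ k) (mat 1) = diag_matrix (\<chi> i. v $ i ^ k)"
proof (induction k)
  case 0
  show ?case by (simp add: diag_matrix_def mat_def vec_eq_iff)
next
  case (Suc k)
  then show ?case
    by (simp add: vec_eq_iff diag_matrix_mult_nth) (simp add: diag_matrix_def)
qed

lemma matrix_exp_diag_matrix: "matrix_exp (diag_matrix v) = diag_matrix (\<chi> i. exp (v $ i))"
proof -
  have "(\<lambda>k. (1 / fact k) *\<^sub>R ((**) (diag_matrix v) ^^ k) (mat 1)) sums diag_matrix (\<chi> i. exp (v $ i))"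
    unfolding diag_matrix_power
  proof (intro sums_vecI)
    fix i j
    show "(\<lambda>k. ((1 / fact k) *\<^sub>R diag_matrix (\<chi> i. v $ i ^ k)) $ i $ j) sums diag_matrix (\<chi> i. exp (v $ i)) $ i $ j"
      using exp_converges[of "v $ i"] by (cases "i = j") (simp_all add: diag_matrix_def divide_inverse)
  qed
  then show ?thesis unfolding matrix_exp_def by (simp add: sums_iff)
qed

text \<open>The column of ones copies the signal into every row, and the diagonal exponential
  weights row \<open>i\<close> by its own eigenvalue only.\<close>

lemma T_integrand_diag_matrix_nth:
  fixes \<Lambda> :: "complex^'m"
  shows "T_integrand (diag_matrix \<Lambda>) w s $ i $ j = exp (- (\<Lambda> $ i * of_real s)) * w s $ j"
proof -
  have "(- s) *\<^sub>R diag_matrix \<Lambda> = diag_matrix (\<chi> i. - (\<Lambda> $ i * of_real s))"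
    by (simp add: diag_matrix_def vec_eq_iff scaleR_conv_of_real[where 'a = complex])
  then have "T_integrand (diag_matrix \<Lambda>) w s =
      diag_matrix (\<chi> i. exp (- (\<Lambda> $ i * of_real s))) ** ((columnvector (vec 1) :: complex^1^'m) ** rowvector (w s))"
    by (simp only: T_integrand_def matrix_exp_diag_matrix matrix_mul_assoc[symmetric] vec_lambda_beta)
  moreover have "((columnvector (vec 1) :: complex^1^'m) ** rowvector (w s)) $ i $ j = w s $ j"
    by (simp only: matrix_matrix_mult_def columnvector_def rowvector_def sum_1 vec_lambda_beta vec_component
        mult_1_left)
  ultimately show ?thesis by (simp only: diag_matrix_mult_nth vec_lambda_beta)
qed

section \<open>Componentwise integration\<close>

lemma set_integrable_vecI:
  fixes F :: "'b \<Rightarrow> 'a::euclidean_space^'n"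
  assumes "\<And>i. set_integrable M A (\<lambda>s. F s $ i)"
  shows "set_integrable M A F"
proof -
  have "bounded_linear (axis i :: 'a \<Rightarrow> 'a^'n)" for i :: 'n
    unfolding linear_conv_bounded_linear[symmetric]
    by (rule linearI) (simp_all add: axis_def vec_eq_iff)
  then have "integrable M (\<lambda>s. \<Sum>i\<in>UNIV. axis i (indicator A s *\<^sub>R F s $ i) :: 'a^'n)"
    using integrable_bounded_linear[of "axis _" M] assms unfolding set_integrable_def
    by (intro Bochner_Integration.integrable_sum) blast
  moreover have "(\<Sum>i\<in>UNIV. axis i (indicator A s *\<^sub>R F s $ i)) = indicator A s *\<^sub>R F s" for s
    by (simp add: vec_eq_iff axis_def)
  ultimately show ?thesis unfolding set_integrable_def by simp
qed

lemma set_integral_vec_nth: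
  fixes F :: "'b \<Rightarrow> 'a::euclidean_space^'n"
  assumes "set_integrable M A F"
  shows "(LINT s:A|M. F s) $ i = (LINT s:A|M. F s $ i)"
  using integral_bounded_linear[OF bounded_linear_vec_nth assms[unfolded set_integrable_def]]
  by (simp add: set_lebesgue_integral_def)

lemma open_enlarge: "open (enlarge S \<delta>)"
  by (auto simp: enlarge_def)

lemma enlarge_mono: "\<delta> \<le> \<delta>' \<Longrightarrow> enlarge S \<delta> \<subseteq> enlarge S \<delta>'"
  by (force simp: enlarge_def)

lemma closure_subset_enlarge: "\<delta> > 0 \<Longrightarrow> closure S \<subseteq> enlarge S \<delta>"
  by (auto simp: enlarge_def closure_approachable dist_commute)

section \<open>Injectivity of the observer map\<close>

text \<open>The hypothesis \<open>lip\<close> says that a difference of signals is again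
  exponentially bounded, with a constant proportional to the distance;
  \<open>norm_laplace_le\<close> is linear in that constant.\<close>

lemma holo_family_laplace:
  assumes cont: "\<And>x. x \<in> Y \<Longrightarrow> continuous_on {..0} (w x)"
    and bd: "\<And>x s. x \<in> Y \<Longrightarrow> s \<le> 0 \<Longrightarrow> norm (w x s) \<le> M x * exp (l * s)"
    and lip: "\<And>x0. x0 \<in> Y \<Longrightarrow> \<exists>r>0. \<exists>K\<ge>0. \<forall>x\<in>Y \<inter> ball x0 r. \<forall>x'\<in>Y \<inter> ball x0 r. \<forall>s\<le>0.
      norm (w x s - w x' s) \<le> K * dist x x' * exp (l * s)"
  shows "holo_family Y {z. Re z < l} (\<lambda>x. laplace (w x))"
  unfolding holo_family_def
proof (intro conjI ballI)
  show "laplace (w x) holomorphic_on {z. Re z < l}" if "x \<in> Y" for x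
    using laplace_holomorphic[OF cont bd] that by blast
  fix x0 z0 assume "x0 \<in> Y" and z0: "z0 \<in> {z. Re z < l}"
  obtain r1 K where r1: "r1 > 0" "K \<ge> 0"
    and K: "\<And>x x' s. \<lbrakk>x \<in> Y \<inter> ball x0 r1; x' \<in> Y \<inter> ball x0 r1; s \<le> 0\<rbrakk>
      \<Longrightarrow> norm (w x s - w x' s) \<le> K * dist x x' * exp (l * s)"
    using lip[OF \<open>x0 \<in> Y\<close>] by metis
  define d where "d = (l - Re z0) / 2"
  have d: "d > 0" using z0 by (simp add: d_def)
  define r where "r = min r1 d"
  define E where "E = (LBINT s:{..0}. exp (d * s))"
  have "E \<ge> 0" unfolding E_def set_lebesgue_integral_def by (rule Bochner_Integration.integral_nonneg) simp
  have Re_d: "d \<le> l - Re z" if "z \<in> cball z0 r" for z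
  proof -
    have "Re z - Re z0 \<le> norm (z - z0)" using complex_Re_le_cmod[of "z - z0"] by simp
    also have "\<dots> \<le> d" using that by (simp add: r_def dist_norm norm_minus_commute)
    finally show ?thesis by (simp add: d_def field_simps)
  qed
  have "norm (laplace (w x) z - laplace (w x') z) \<le> (K * E) * dist x x'"
    if x: "x \<in> Y \<inter> ball x0 r" "x' \<in> Y \<inter> ball x0 r" and z: "z \<in> cball z0 r" for x x' z
  proof -
    have \<phi>: "exp_bounded l (M x) (w x)" "exp_bounded l (M x') (w x')"
      using exp_bounded_continuous[OF cont bd] x by blast+
    have "exp_bounded l (K * dist x x') (\<lambda>s. w x s - w x' s)"
      using cont x by (intro exp_bounded_continuous K continuous_intros) (auto simp: r_def)
    then have "norm (laplace (\<lambda>s. w x s - w x' s) z) \<le> K * dist x x' * E"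
      unfolding E_def using d Re_d[OF z] by (rule norm_laplace_le)
    moreover have "Re z < l" using Re_d[OF z] d by simp
    ultimately show ?thesis using laplace_diff[OF \<phi>] by (simp add: mult_ac)
  qed
  moreover have "cball z0 r \<subseteq> {z. Re z < l}" using Re_d d by force
  ultimately show "\<exists>r>0. \<exists>L\<ge>0. cball z0 r \<subseteq> {z. Re z < l} \<and>
      (\<forall>x\<in>Y \<inter> ball x0 r. \<forall>x'\<in>Y \<inter> ball x0 r. \<forall>z\<in>cball z0 r.
        norm (laplace (w x) z - laplace (w x') z) \<le> L * dist x x')"
    using r1 d \<open>E \<ge> 0\<close> by (intro exI[of _ r] exI[of _ "K * E"] conjI) (auto simp: r_def)
qed

lemma holo_family_pair_diff:
  assumes F: "holo_family Y \<Omega> F" and P: "P \<subseteq> Y \<times> Y"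
  shows "holo_family P \<Omega> (\<lambda>p z. F (fst p) z - F (snd p) z)"
  unfolding holo_family_def
proof (intro conjI ballI)
  show "(\<lambda>z. F (fst p) z - F (snd p) z) holomorphic_on \<Omega>" if "p \<in> P" for p
    using F P that by (intro holomorphic_intros) (auto simp: holo_family_def)
  fix p0 z0 assume p0: "p0 \<in> P" and z0: "z0 \<in> \<Omega>"
  have p0Y: "fst p0 \<in> Y" "snd p0 \<in> Y" using p0 P by auto
  obtain r1 L1 where r1: "r1 > 0" "L1 \<ge> 0" "cball z0 r1 \<subseteq> \<Omega>"
    and L1: "\<And>x x' z. \<lbrakk>x \<in> Y; x' \<in> Y; dist (fst p0) x < r1; dist (fst p0) x' < r1; dist z0 z \<le> r1\<rbrakk>
      \<Longrightarrow> norm (F x z - F x' z) \<le> L1 * dist x x'"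
    using holo_familyE[OF F p0Y(1) z0] by metis
  obtain r2 L2 where r2: "r2 > 0" "L2 \<ge> 0" "cball z0 r2 \<subseteq> \<Omega>"
    and L2: "\<And>x x' z. \<lbrakk>x \<in> Y; x' \<in> Y; dist (snd p0) x < r2; dist (snd p0) x' < r2; dist z0 z \<le> r2\<rbrakk>
      \<Longrightarrow> norm (F x z - F x' z) \<le> L2 * dist x x'"
    using holo_familyE[OF F p0Y(2) z0] by metis
  define r where "r = min r1 r2"
  have "norm ((F (fst p) z - F (snd p) z) - (F (fst q) z - F (snd q) z)) \<le> (L1 + L2) * dist p q"
    if pq: "p \<in> P \<inter> ball p0 r" "q \<in> P \<inter> ball p0 r" and z: "z \<in> cball z0 r" for p q z
  proof -
    have Y: "fst p \<in> Y" "snd p \<in> Y" "fst q \<in> Y" "snd q \<in> Y" using pq P by auto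
    have near: "dist (fst p0) (fst p) < r" "dist (snd p0) (snd p) < r"
      "dist (fst p0) (fst q) < r" "dist (snd p0) (snd q) < r"
      using pq dist_fst_le[of p0 p] dist_snd_le[of p0 p] dist_fst_le[of p0 q] dist_snd_le[of p0 q]
      by auto
    have "norm ((F (fst p) z - F (snd p) z) - (F (fst q) z - F (snd q) z))
        \<le> norm (F (fst p) z - F (fst q) z) + norm (F (snd p) z - F (snd q) z)"
      using norm_triangle_ineq4[of "F (fst p) z - F (fst q) z" "F (snd p) z - F (snd q) z"]
      by (simp add: algebra_simps)
    also have "\<dots> \<le> L1 * dist (fst p) (fst q) + L2 * dist (snd p) (snd q)"
      using Y near z by (intro add_mono L1 L2) (auto simp: r_def)
    also have "\<dots> \<le> L1 * dist p q + L2 * dist p q"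
      using r1 r2 by (intro add_mono mult_left_mono dist_fst_le dist_snd_le)
    finally show ?thesis by (simp add: algebra_simps)
  qed
  moreover have "cball z0 r \<subseteq> \<Omega>" using r1 by (auto simp: r_def)
  ultimately show "\<exists>r>0. \<exists>L\<ge>0. cball z0 r \<subseteq> \<Omega> \<and>
      (\<forall>p\<in>P \<inter> ball p0 r. \<forall>q\<in>P \<inter> ball p0 r. \<forall>z\<in>cball z0 r.
        norm ((F (fst p) z - F (snd p) z) - (F (fst q) z - F (snd q) z)) \<le> L * dist p q)"
    using r1 r2 by (intro exI[of _ r] exI[of _ "L1 + L2"] conjI) (auto simp: r_def)
qed

theorem theorem2p7:
  fixes f :: "real^'n \<Rightarrow> real^'n"
    and h :: "real^'n \<Rightarrow> real^'p"
    and \<kappa> :: "real^'n \<Rightarrow> real"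
    and b :: "real^'p \<Rightarrow> complex^'p"
    and M :: "real^'n \<Rightarrow> real"
    and \<O> :: "(real^'n) set"
    and \<delta>\<^sub>\<Upsilon> \<delta>\<^sub>d \<delta>\<^sub>u l :: real
  assumes dim: "CARD('m::finite) = CARD('n) + 1"
    and lip: "locally_lipschitz f" "locally_lipschitz h" "locally_lipschitz \<kappa>"
    and O_open: "open \<O>"
    and \<delta>u: "\<delta>\<^sub>u > 0"
    and complete: "backward_complete_within f (enlarge \<O> \<delta>\<^sub>u)"
    and disting: "backward_distinguishable_with f h \<O> \<delta>\<^sub>\<Upsilon> \<delta>\<^sub>d"
    and \<delta>d: "0 < \<delta>\<^sub>d" "\<delta>\<^sub>d < \<delta>\<^sub>u"
    and chi_one: "\<And>x. x \<in> enlarge \<O> \<delta>\<^sub>d \<Longrightarrow> \<kappa> x = 1"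
    and chi_zero: "\<And>x. x \<notin> enlarge \<O> \<delta>\<^sub>u \<Longrightarrow> \<kappa> x = 0"
    and chi_blowup: "\<And>x. x \<in> enlarge \<O> \<delta>\<^sub>\<Upsilon> \<Longrightarrow> no_cutoff_blowup f \<kappa> x"
    and smooth: "\<And>t. C1_on (\<lambda>x. b (h (flow (cut \<kappa> f) x t))) {x. t \<in> max_interval (cut \<kappa> f) UNIV x}"
    and b: "inj b" "C1_on b UNIV"
    and M: "continuous_on (enlarge \<O> \<delta>\<^sub>\<Upsilon>) M" "\<And>x. x \<in> enlarge \<O> \<delta>\<^sub>\<Upsilon> \<Longrightarrow> M x \<ge> 0"
    and l_neg: "l < 0"
    and bound: "\<And>x t. x \<in> enlarge \<O> \<delta>\<^sub>\<Upsilon> \<Longrightarrow> sigma_minus (cut \<kappa> f) UNIV x < ereal t \<Longrightarrow> t \<le> 0 \<Longrightarrow>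
        norm (exp (- l * t) *\<^sub>R b (h (flow (cut \<kappa> f) x t)))
        + onorm (\<lambda>v. exp (- l * t) *\<^sub>R frechet_derivative (\<lambda>y. b (h (flow (cut \<kappa> f) y t))) (at x) v)
        \<le> M x"
  shows "\<exists>S :: (complex^'m) set. S \<in> null_sets lebesgue \<and>
    (\<forall>\<Lambda> :: complex^'m. \<Lambda> \<notin> S \<and> (\<forall>i. Re (\<Lambda> $ i) < l) \<longrightarrow>
      (\<forall>x\<in>closure \<O>. sigma_minus (cut \<kappa> f) UNIV x = -\<infinity> \<and>
         set_integrable lborel {..0} (T_integrand (diag_matrix \<Lambda>) (\<lambda>s. b (h (flow (cut \<kappa> f) x s))))) \<and>
      inj_on (T_map (diag_matrix \<Lambda>) (\<lambda>x s. b (h (flow (cut \<kappa> f) x s)))) (closure \<O>))"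
proof -
  define c where "c = cut \<kappa> f"
  define Y where "Y = enlarge \<O> \<delta>\<^sub>\<Upsilon>"
  define w where "w x s = b (h (flow c x s))" for x s
  have c: "locally_lipschitz c" unfolding c_def by (rule locally_lipschitz_scaleR[OF lip(3,1)])
  have \<delta>: "0 < \<delta>\<^sub>\<Upsilon>" "\<delta>\<^sub>\<Upsilon> < \<delta>\<^sub>d" using disting by (auto simp: backward_distinguishable_with_def)
  have "open Y" unfolding Y_def by (rule open_enlarge)
  have closure_Y: "closure \<O> \<subseteq> Y" unfolding Y_def by (rule closure_subset_enlarge[OF \<delta>(1)])
  have Y_d: "Y \<subseteq> enlarge \<O> \<delta>\<^sub>d" unfolding Y_def using \<delta> by (intro enlarge_mono) simp

  \<comment> \<open>The open set on which the cut-off is 1 is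
    \<open>enlarge \<O> \<delta>\<^sub>d\<close>; it contains \<open>Y\<close>.\<close>
  have minf: "sigma_minus c UNIV x = -\<infinity>" if "x \<in> Y" for x
    unfolding c_def
    by (rule cut_backward_complete[OF lip(1,3) complete chi_zero open_enlarge _ chi_one chi_blowup])
      (use that Y_d in \<open>auto simp: Y_def\<close>)
  have dom: "t \<in> max_interval c UNIV x" if xt: "x \<in> Y" "t \<le> 0" for x t
  proof -
    obtain J u where "solves_in c UNIV x J u" "{t..0} \<subseteq> J"
      using sigma_minus_less_imp_solution[of c UNIV x t] minf[OF xt(1)] xt(2) by auto
    moreover from this have "t \<in> J" using xt by auto
    ultimately show ?thesis unfolding mem_max_interval by blast
  qed
  have cont_b: "continuous_on UNIV b"
    using b(2) unfolding C1_on_def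
    by (auto intro!: continuous_at_imp_continuous_on dest: has_derivative_continuous)
  have cont_w: "continuous_on {..0} (w x)" if "x \<in> Y" for x
  proof -
    have "continuous_on (max_interval c UNIV x) (flow c x)"
      using dom[OF that] by (intro solves_in_continuous[OF solves_in_max_interval[OF c]]) auto
    then have "continuous_on {..0} (flow c x)"
      by (rule continuous_on_subset) (use dom[OF that] in auto)
    then have "continuous_on {..0} (\<lambda>s. h (flow c x s))"
      by (rule continuous_on_compose2[OF locally_lipschitz_continuous_on[OF lip(2), of UNIV]]) auto
    then show ?thesis unfolding w_def
      by (rule continuous_on_compose2[OF cont_b]) auto
  qed
  have deriv_w: "\<exists>D. ((\<lambda>y. w y t) has_derivative D) (at x) \<and>
      norm (w x t) + onorm D \<le> M x * exp (l * t)" if xt: "x \<in> Y" "t \<le> 0" for x t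
  proof -
    obtain D where D: "((\<lambda>y. w y t) has_derivative D) (at x)"
      using smooth[of t] dom[OF xt] unfolding C1_on_def w_def c_def by blast
    have D_eq: "D = frechet_derivative (\<lambda>y. w y t) (at x)" by (rule frechet_derivative_at[OF D])
    have "sigma_minus (cut \<kappa> f) UNIV x < ereal t" using minf[OF that(1)] by (simp add: c_def)
    then have "norm (exp (- l * t) *\<^sub>R w x t) + onorm (\<lambda>v. exp (- l * t) *\<^sub>R D v) \<le> M x"
      using bound[of x t] that unfolding D_eq w_def c_def Y_def by blast
    then have "exp (- l * t) * (norm (w x t) + onorm D) \<le> M x"
      using onorm_scaleR[OF has_derivative_bounded_linear[OF D]] by (simp add: distrib_left)
    then have "norm (w x t) + onorm D \<le> M x * exp (l * t)"
      by (simp add: exp_minus field_simps)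
    then show ?thesis using D by blast
  qed
  have bd_w: "norm (w x t) \<le> M x * exp (l * t)" if "x \<in> Y" "t \<le> 0" for x t
    using deriv_w[OF that] onorm_pos_le[OF has_derivative_bounded_linear] by fastforce
  \<comment> \<open>Continuity of \<open>M\<close> gives \<open>M y \<le> M x0 + 1\<close> on a
    small ball, one constant for all times; convexity of the ball allows the mean value
    inequality.\<close>
  have lip_w: "\<exists>r>0. \<exists>K\<ge>0. \<forall>x\<in>Y \<inter> ball x0 r. \<forall>x'\<in>Y \<inter> ball x0 r. \<forall>s\<le>0.
      norm (w x s - w x' s) \<le> K * dist x x' * exp (l * s)" if "x0 \<in> Y" for x0
  proof -
    have "isCont M x0" using M(1) \<open>open Y\<close> that by (simp add: Y_def continuous_on_eq_continuous_at)
    then obtain r1 where r1: "r1 > 0" "\<And>x. dist x x0 < r1 \<Longrightarrow> dist (M x) (M x0) < 1"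
      unfolding continuous_at_eps_delta by (metis zero_less_one)
    obtain r2 where r2: "r2 > 0" "ball x0 r2 \<subseteq> Y" using \<open>open Y\<close> \<open>x0 \<in> Y\<close> by (meson openE)
    define r where "r = min r1 r2"
    have "norm (w x s - w x' s) \<le> (M x0 + 1) * dist x x' * exp (l * s)"
      if xs: "x \<in> ball x0 r" "x' \<in> ball x0 r" "s \<le> 0" for x x' s
    proof -
      obtain D where D: "\<And>y. y \<in> Y \<Longrightarrow> ((\<lambda>y. w y s) has_derivative D y) (at y)"
        "\<And>y. y \<in> Y \<Longrightarrow> norm (w y s) + onorm (D y) \<le> M y * exp (l * s)"
        using deriv_w[OF _ \<open>s \<le> 0\<close>] by metis
      have "norm (w x s - w x' s) \<le> ((M x0 + 1) * exp (l * s)) * norm (x - x')"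
      proof (rule differentiable_bound[OF convex_ball, of x0 r])
        fix y assume y: "y \<in> ball x0 r"
        then have "y \<in> Y" using r2 by (auto simp: r_def)
        then show "((\<lambda>y. w y s) has_derivative D y) (at y within ball x0 r)"
          using D(1) has_derivative_at_withinI by blast
        have "M y \<le> M x0 + 1"
          using r1(2)[of y] y by (simp add: r_def dist_commute dist_real_def)
        then have "M y * exp (l * s) \<le> (M x0 + 1) * exp (l * s)" by (intro mult_right_mono) auto
        then show "onorm (D y) \<le> (M x0 + 1) * exp (l * s)"
          using D(2)[OF \<open>y \<in> Y\<close>] norm_ge_zero[of "w y s"] by linarith
      qed (use xs in auto)
      then show ?thesis by (simp add: dist_norm mult_ac)
    qed
    then show ?thesis
      using r1 r2 M(2)[of x0] \<open>x0 \<in> Y\<close> unfolding Y_def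
      by (intro exI[of _ r] exI[of _ "M x0 + 1"] conjI) (auto simp: r_def)
  qed
  define \<Omega> where "\<Omega> = {z :: complex. Re z < l}"
  define F where "F j x z = laplace (\<lambda>s. w x s $ j) z" for j x z
  have cont_wj: "continuous_on {..0} (\<lambda>s. w x s $ j)" if "x \<in> Y" for x j
    using cont_w[OF that] by (intro continuous_intros)
  have bd_wj: "norm (w x s $ j) \<le> M x * exp (l * s)" if "x \<in> Y" "s \<le> 0" for x s j
    using Finite_Cartesian_Product.norm_nth_le[of "w x s" j] bd_w[OF that] by simp
  have exp_bounded_w: "exp_bounded l (M x) (\<lambda>s. w x s $ j)" if "x \<in> Y" for x j
    using exp_bounded_continuous[OF cont_wj bd_wj] that by blast
  have "holo_family Y \<Omega> (F j)" for j
    unfolding \<Omega>_def F_def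
  proof (rule holo_family_laplace[OF cont_wj bd_wj])
    fix x0 assume "x0 \<in> Y"
    then obtain r K where r: "r > 0" "K \<ge> 0" and K: "\<And>x x' s. \<lbrakk>x \<in> Y \<inter> ball x0 r; x' \<in> Y \<inter> ball x0 r; s \<le> 0\<rbrakk>
        \<Longrightarrow> norm (w x s - w x' s) \<le> K * dist x x' * exp (l * s)"
      using lip_w by meson
    have "norm (w x s $ j - w x' s $ j) \<le> norm (w x s - w x' s)" for x x' s
      using Finite_Cartesian_Product.norm_nth_le[of "w x s - w x' s" j] by simp
    then show "\<exists>r>0. \<exists>K\<ge>0. \<forall>x\<in>Y \<inter> ball x0 r. \<forall>x'\<in>Y \<inter> ball x0 r. \<forall>s\<le>0.
        norm (w x s $ j - w x' s $ j) \<le> K * dist x x' * exp (l * s)"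
      using r K by (meson order_trans)
  qed
  define P where "P = {p \<in> Y \<times> Y. fst p \<noteq> snd p}"
  define g where "g j p z = F j (fst p) z - F j (snd p) z" for j p z
  have g: "holo_family P \<Omega> (g j)" for j
    unfolding g_def by (rule holo_family_pair_diff[OF \<open>holo_family Y \<Omega> (F j)\<close>]) (auto simp: P_def)
  \<comment> \<open>Distinguishability concerns the flow of \<open>f\<close>, but only at times up
    to which it stays in the region where the cut-off is 1.\<close>
  have flow_agree: "flow c x t = flow f x t" if "sigma_minus f (enlarge \<O> \<delta>\<^sub>d) x < ereal t" "t \<le> 0" for x t
  proof -
    obtain J u where J: "solves_in f (enlarge \<O> \<delta>\<^sub>d) x J u" "{t..0} \<subseteq> J"
      using sigma_minus_less_imp_solution \<open>sigma_minus f (enlarge \<O> \<delta>\<^sub>d) x < ereal t\<close> \<open>t \<le> 0\<close> by blast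
    have "solves_in c (enlarge \<O> \<delta>\<^sub>d) x J u"
      using J(1) by (intro solves_in_subset[OF J(1)]) (auto simp: solves_in_def c_def chi_one)
    moreover have "t \<in> J" using J \<open>t \<le> 0\<close> by auto
    ultimately show ?thesis
      using flow_eq[OF c solves_in_UNIV] flow_eq[OF lip(1) solves_in_UNIV[OF J(1)]] by simp
  qed
  have nz: "\<exists>j. \<exists>z\<in>\<Omega>. g j p z \<noteq> 0" if pP: "p \<in> P" for p
  proof (rule ccontr)
    assume "\<nexists>j. \<exists>z\<in>\<Omega>. g j p z \<noteq> 0"
    then have zero: "\<And>j z. z \<in> \<Omega> \<Longrightarrow> g j p z = 0" by blast
    obtain x1 x2 where p: "p = (x1, x2)" "x1 \<in> Y" "x2 \<in> Y" "x1 \<noteq> x2"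
      using pP by (auto simp: P_def)
    obtain t where t: "sigma_minus f (enlarge \<O> \<delta>\<^sub>d) x1 < ereal t" "sigma_minus f (enlarge \<O> \<delta>\<^sub>d) x2 < ereal t"
      "t \<le> 0" "h (flow f x1 t) \<noteq> h (flow f x2 t)"
      using disting p unfolding backward_distinguishable_with_def Y_def by (metis max_less_iff_conj)
    then have "w x1 t \<noteq> w x2 t"
      unfolding w_def using flow_agree b(1) by (metis injD)
    then obtain j where j: "w x1 t $ j \<noteq> w x2 t $ j" by (auto simp: vec_eq_iff)
    have "w x1 t $ j - w x2 t $ j = 0"
    proof (rule laplace_eq_0_imp_eq_0[where l = l and C = "M x1 + M x2"])
      show "continuous_on {..0} (\<lambda>s. w x1 s $ j - w x2 s $ j)"
        using cont_wj p by (intro continuous_on_diff) auto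
      show "norm (w x1 s $ j - w x2 s $ j) \<le> (M x1 + M x2) * exp (l * s)" if "s \<le> 0" for s
        using exp_bounded_diff[OF exp_bounded_w exp_bounded_w] p that by (simp add: exp_bounded_def)
      show "laplace (\<lambda>s. w x1 s $ j - w x2 s $ j) z = 0" if "Re z < l" for z
        using zero[of z j] that laplace_diff[OF exp_bounded_w[OF p(2)] exp_bounded_w[OF p(3)] that]
        by (simp add: g_def F_def p \<Omega>_def)
    qed (rule t)
    then show False using j by simp
  qed
  \<comment> \<open>These are exactly the spectra in the half-plane for which some pair of distinct
    points of \<open>Y\<close> has equal transforms at every eigenvalue.\<close>
  define S where "S = {\<Lambda> :: complex^'m. \<exists>p\<in>P. \<forall>i. \<Lambda> $ i \<in> \<Omega> \<and> (\<forall>j. g j p (\<Lambda> $ i) = 0)}"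
  have "negligible S"
    unfolding S_def
  proof (rule negligible_common_zeros[OF _ _ _ g nz])
    show "DIM((real^'n) \<times> (real^'n)) < 2 * CARD('m)" using dim by simp
    show "open \<Omega>" "connected \<Omega>"
      unfolding \<Omega>_def by (auto intro: open_halfspace_Re_lt convex_connected convex_halfspace_Re_lt)
  qed
  then have "S \<in> null_sets lebesgue" by (simp add: negligible_iff_null_sets)
  moreover have integrable: "set_integrable lborel {..0} (T_integrand (diag_matrix \<Lambda>) (w x))"
    if "x \<in> Y" "\<forall>i. Re (\<Lambda> $ i) < l" for x and \<Lambda> :: "complex^'m"
    using that by (intro set_integrable_vecI)
      (auto simp: T_integrand_diag_matrix_nth intro!: laplace_integrable[OF exp_bounded_w])
  moreover have "inj_on (T_map (diag_matrix \<Lambda>) w) (closure \<O>)"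
    if \<Lambda>: "\<Lambda> \<notin> S" "\<forall>i. Re (\<Lambda> $ i) < l" for \<Lambda> :: "complex^'m"
  proof (rule inj_onI, rule ccontr)
    fix x1 x2 assume x: "x1 \<in> closure \<O>" "x2 \<in> closure \<O>"
      and eq: "T_map (diag_matrix \<Lambda>) w x1 = T_map (diag_matrix \<Lambda>) w x2" and "x1 \<noteq> x2"
    then have xY: "x1 \<in> Y" "x2 \<in> Y" and P: "(x1, x2) \<in> P" using closure_Y by (auto simp: P_def)
    have T: "T_map (diag_matrix \<Lambda>) w x $ i $ j = F j x (\<Lambda> $ i)" if "x \<in> Y" for x i j
    proof -
      \<comment> \<open>A matrix is a vector of rows, so its integral is split twice, with
        integrability required for the matrix and for the row.\<close>
      have int: "set_integrable lborel {..0} (T_integrand (diag_matrix \<Lambda>) (w x))"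
        using integrable[OF that \<Lambda>(2)] .
      have "set_integrable lborel {..0} (\<lambda>s. T_integrand (diag_matrix \<Lambda>) (w x) s $ i)"
        using integrable_bounded_linear[OF bounded_linear_vec_nth int[unfolded set_integrable_def], of i]
        by (simp add: set_integrable_def)
      then show ?thesis
        unfolding T_map_def F_def laplace_def
        by (simp add: set_integral_vec_nth[OF int] set_integral_vec_nth T_integrand_diag_matrix_nth)
    qed
    have "g j (x1, x2) (\<Lambda> $ i) = 0" for i j
      using T[OF xY(1), of i j] T[OF xY(2), of i j] eq by (simp add: g_def)
    then have "\<Lambda> \<in> S" using P \<Lambda>(2) by (auto simp: S_def \<Omega>_def)
    then show False using \<Lambda>(1) by blast
  qed
  moreover have "w = (\<lambda>x s. b (h (flow (cut \<kappa> f) x s)))"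
    by (simp add: w_def c_def fun_eq_iff)
  ultimately show ?thesis
    using minf closure_Y unfolding c_def by (intro exI[of _ S]) auto
qed

end
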